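(* Let $n\ge2$. Let $v=v(\eta^2,\eta^3,\dots,\eta^{2n},\tau)$ and $u=u(\eta^2,\eta^3,\dots,\eta^{2n},\tau)$ be two $C^\infty$ smooth intrinsic graphs (in the Heisenberg group $H_n$) defined on a neighborhood $U$ of $p_0=(\eta_0^2,\dots,\eta_0^{2n},\tau_0)$. Assume $v=u$ at $p_0$, where $v_{\eta^{n+1}}\ne0$ and $u_{\eta^{n+1}}\neq0$. Suppose $v\ge u$ and $$W^v\cdot\left(\frac{W^v(v)}{\sqrt{1+|W^v(v)|^2}}\right)\le W^u\cdot\left(\frac{W^u(u)}{\sqrt{1+|W^u(u)|^2}}\right)$$ in $U$, and that either $v$ or $u$ has constant horizontal ($p$-)mean curvature. Then $v\equiv u$ near $p_0$.
   Context: $H_n=\mathbb{R}^{2n+1}$ with coordinates $(x^1,\dots,x^{2n},z)$ and group law $(a_1,\dots,a_n,b_1,\dots,b_n,c)\circ(x_1,\dots,x_n,y_1,\dots,y_n,z)=(a_1+x_1,\dots,b_n+y_n,\,c+z+\sum_j(b_jx_j-a_jy_j))$ ($x^j=x_j$, $x^{n+j}=y_j$). An intrinsic graph $u$ is the hypersurface $(0,\eta^2,\dots,\eta^{2n},\tau)\circ(u(\eta^2,\dots,\eta^{2n},\tau),0,\dots,0)$, i.e. $x^1=u$, $x^j=\eta^j$ ($2\le j\le2n$), $z=\tau+\eta^{n+1}u$. On functions of $(\eta^2,\dots,\eta^{2n},\tau)$ let $$\mathring e_j=\partial_{\eta^j}+\eta^{n+j}\partial_\tau,\quad \mathring e_{n+j}=\partial_{\eta^{n+j}}-\eta^j\partial_\tau\quad(2\le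 j\le n),\qquad \mathring e^u_{n+1}=\partial_{\eta^{n+1}}-2u\,\partial_\tau,$$ and $W^u:=(\mathring e_2,\dots,\mathring e_n,\mathring e^u_{n+1},\mathring e_{n+2},\dots,\mathring e_{2n})$. $W^u(u)$ is the vector obtained by applying each component of $W^u$ to $u$, and $W^u\cdot(f_2,\dots,f_{2n})$ is the sum of each component of $W^u$ applied to the corresponding $f_j$. The horizontal ($p$-)mean curvature of the intrinsic graph $u$ is $W^u\cdot\big(W^u(u)/\sqrt{1+|W^u(u)|^2}\big)$. *)

theory Defs
  imports "HOL-Analysis.Analysis"
begin

text \<open>
  The index type \<open>'m\<close> stands for \<open>{2,...,n}\<close>, so \<open>n = CARD('m) + 1\<close>; since types are nonempty,
  \<open>n\<close> ranges over exactly the integers \<open>\<ge> 2\<close>.  A parameter point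
  \<open>(\<eta>^2,...,\<eta>^(2n),\<tau>)\<close> is grouped as
  \<open>((\<eta>^j), \<eta>^(n+1), (\<eta>^(n+j)), \<tau>)\<close> with \<open>2 \<le> j \<le> n\<close>.
  A function \<open>u\<close> of these parameters is identified with its intrinsic graph in the Heisenberg group
  \<open>H_n\<close>, i.e. the hypersurface \<open>x^1 = u\<close>, \<open>x^j = \<eta>^j\<close> \<open>(2 \<le> j \<le> 2n)\<close>,
  \<open>z = \<tau> + \<eta>^(n+1) u\<close>.
\<close>

type_synonym 'm param = "(real ^ 'm) \<times> real \<times> (real ^ 'm) \<times> real"

text \<open>Values of \<open>W\<^sup>u\<close>, ordered by the indices \<open>2,...,n\<close>, then \<open>n+1\<close>, then \<open>n+2,...,2n\<close>.\<close>

type_synonym 'm horiz = "(real ^ 'm) \<times> real \<times> (real ^ 'm)"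

definition partial :: "'a \<Rightarrow> ('a::euclidean_space \<Rightarrow> real) \<Rightarrow> 'a \<Rightarrow> real"
  where "partial b f p = frechet_derivative f (at p) b"

text \<open>Continuous differentiability of order \<open>k\<close>; only meaningful for open \<open>U\<close>.\<close>

primrec Ck_on :: "nat \<Rightarrow> ('a::euclidean_space \<Rightarrow> real) \<Rightarrow> 'a set \<Rightarrow> bool"
  where
    "Ck_on 0 f U \<longleftrightarrow> continuous_on U f"
  | "Ck_on (Suc k) f U \<longleftrightarrow> f differentiable_on U \<and> (\<forall>b\<in>Basis. Ck_on k (partial b f) U)"

definition smooth_on :: "('a::euclidean_space \<Rightarrow> real) \<Rightarrow> 'a set \<Rightarrow> bool"
  where "smooth_on f U \<longleftrightarrow> (\<forall>k. Ck_on k f U)"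

definition d_lo :: "'m::finite \<Rightarrow> ('m param \<Rightarrow> real) \<Rightarrow> 'm param \<Rightarrow> real"
  where "d_lo j = partial (axis j 1, 0, 0, 0)"

definition d_mid :: "('m::finite param \<Rightarrow> real) \<Rightarrow> 'm param \<Rightarrow> real"
  where "d_mid = partial (0, 1, 0, 0)"

definition d_hi :: "'m::finite \<Rightarrow> ('m param \<Rightarrow> real) \<Rightarrow> 'm param \<Rightarrow> real"
  where "d_hi j = partial (0, 0, axis j 1, 0)"

definition d_tau :: "('m::finite param \<Rightarrow> real) \<Rightarrow> 'm param \<Rightarrow> real"
  where "d_tau = partial (0, 0, 0, 1)"

text \<open>The operators with index \<open>j\<close>, \<open>n+1\<close> and \<open>n+j\<close> respectively, where \<open>2 \<le> j \<le> n\<close>.\<close>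

definition e_lo :: "'m::finite \<Rightarrow> ('m param \<Rightarrow> real) \<Rightarrow> 'm param \<Rightarrow> real"
  where "e_lo j f = (\<lambda>(x, s, y, t). d_lo j f (x, s, y, t) + y $ j * d_tau f (x, s, y, t))"

definition e_mid :: "('m::finite param \<Rightarrow> real) \<Rightarrow> ('m param \<Rightarrow> real) \<Rightarrow> 'm param \<Rightarrow> real"
  where "e_mid u f p = d_mid f p - 2 * u p * d_tau f p"

definition e_hi :: "'m::finite \<Rightarrow> ('m param \<Rightarrow> real) \<Rightarrow> 'm param \<Rightarrow> real"
  where "e_hi j f = (\<lambda>(x, s, y, t). d_hi j f (x, s, y, t) - x $ j * d_tau f (x, s, y, t))"

definition W_grad :: "('m::finite param \<Rightarrow> real) \<Rightarrow> ('m param \<Rightarrow> real) \<Rightarrow> 'm param \<Rightarrow> 'm horiz"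
  where "W_grad u f p = ((\<chi> j. e_lo j f p), e_mid u f p, (\<chi> j. e_hi j f p))"

definition W_div :: "('m::finite param \<Rightarrow> real) \<Rightarrow> ('m param \<Rightarrow> 'm horiz) \<Rightarrow> 'm param \<Rightarrow> real"
  where "W_div u F p =
    (\<Sum>j\<in>UNIV. e_lo j (\<lambda>q. fst (F q) $ j) p)
    + e_mid u (\<lambda>q. fst (snd (F q))) p
    + (\<Sum>j\<in>UNIV. e_hi j (\<lambda>q. snd (snd (F q)) $ j) p)"

text \<open>The norm of the product type \<open>'m horiz\<close> is the Euclidean norm on its \<open>2n-1\<close> components.\<close>

definition p_mean_curvature :: "('m::finite param \<Rightarrow> real) \<Rightarrow> 'm param \<Rightarrow> real"
  where "p_mean_curvature u =
    W_div u (\<lambda>p. W_grad u u p /\<^sub>R sqrt (1 + (norm (W_grad u u p))\<^sup>2))"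

end

theory Submission
  imports Defs
begin

text \<open>
  Put \<open>w = v - u \<ge> 0\<close> and \<open>F = {w = 0}\<close>. Subtracting the two curvature expressions gives, on
  compact sets, \<open>L w \<le> C (w + |Dw|)\<close> for a linear second order operator \<open>L\<close> that is elliptic in the
  directions of \<open>W\<^sup>v\<close>. Hopf's barrier \<open>exp (\<alpha> \<phi>) - 1\<close> then shows that all fields of \<open>W\<^sup>v\<close> are
  tangent to \<open>F\<close> in Bony's sense: their derivatives of \<open>\<phi>\<close> vanish whenever \<open>\<phi>\<close>, restricted to \<open>F\<close>,
  has a local maximum. Since \<open>w \<ge> 0\<close>, no sign of the zero order term is needed.

  The fields with index \<open>j\<close> and \<open>n+j\<close> (available because \<open>n \<ge> 2\<close>) have explicit straight flow lines,
  along which \<open>F\<close> is invariant; the commutator of these flows is a translation in \<open>\<tau>\<close>. Modulo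
  \<open>\<partial>\<^sub>\<tau>\<close> the fields of \<open>W\<^sup>v\<close> span all directions, so a set with these invariances has no boundary
  point near \<open>p\<^sub>0\<close>.
\<close>

subsection \<open>Twice differentiable functions\<close>

text \<open>The operator is degenerate, with \<open>2n-1\<close> fields in \<open>2n\<close>
  variables, so the classical strong maximum principle does not apply. The middle field carries the
  coefficient \<open>-2v\<close>, and its flow is not explicit; it therefore enters only through
  tangency at a single point, in the last geometric step. Only fields free of \<open>v\<close> are
  ever integrated. The linearisation inserts the curvature expression with the 1-jet of
  \<open>v\<close> and the second differential of \<open>u\<close>. Compared with the curvature of
  \<open>v\<close> it differs by \<open>mc_form\<close> of the second differential of
  \<open>w\<close> along the fields of \<open>v\<close>; compared with that of \<open>u\<close>,
  only the 1-jet changes. The resulting error contains the full gradient of \<open>w\<close>, not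
  just the horizontal part. The barrier tolerates this: at a minimum of
  \<open>w - \<epsilon> * g\<close> the gradients of \<open>w\<close> and
  \<open>\<epsilon> * g\<close> agree, so the error grows linearly in \<alpha>, against
  \<open>\<alpha>\<^sup>2\<close> times the squared derivatives of \<phi> along the fields.\<close>

text \<open>In \<open>f2 z a b\<close> the slot \<open>b\<close> is differentiated first. Symmetry
  in \<open>a\<close> and \<open>b\<close> is not part of the notion; linearity in both slots is
  derived on open sets.\<close>

definition C2_with :: "'a::euclidean_space set \<Rightarrow> ('a \<Rightarrow> real) \<Rightarrow> ('a \<Rightarrow> 'a \<Rightarrow> real) \<Rightarrow> ('a \<Rightarrow> 'a \<Rightarrow> 'a \<Rightarrow> real) \<Rightarrow> bool"
  where "C2_with U f f1 f2 \<longleftrightarrow>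
    (\<forall>z\<in>U. (f has_derivative f1 z) (at z)) \<and>
    (\<forall>z\<in>U. \<forall>b. ((\<lambda>z. f1 z b) has_derivative (\<lambda>a. f2 z a b)) (at z)) \<and>
    (\<forall>a b. continuous_on U (\<lambda>z. f2 z a b))"

lemma C2_withD:
  assumes "C2_with U f f1 f2" "z \<in> U"
  shows "(f has_derivative f1 z) (at z)"
    and "((\<lambda>z. f1 z b) has_derivative (\<lambda>a. f2 z a b)) (at z)"
  using assms by (auto simp: C2_with_def)

text \<open>Linearity in the second slot comes from uniqueness of derivatives:
  \<open>f1 y (b + c)\<close> and \<open>f1 y b + f1 y c\<close> agree for all \<open>y\<close> near
  \<open>z\<close>, hence so do their derivatives.\<close>

lemma C2_with_linear:
  assumes C: "C2_with U f f1 f2" and "open U" and z: "z \<in> U"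
  shows "linear (f1 z)" "linear (\<lambda>a. f2 z a b)" "linear (f2 z a)"
proof -
  have lin1: "linear (f1 y)" if "y \<in> U" for y
    using C2_withD(1)[OF C that] has_derivative_linear by blast
  show "linear (f1 z)" by (rule lin1[OF z])
  show "linear (\<lambda>a. f2 z a b)" using C2_withD(2)[OF C z] has_derivative_linear by blast
  show "linear (f2 z a)"
  proof (rule linearI)
    fix b c
    have "((\<lambda>y. f1 y b + f1 y c) has_derivative (\<lambda>a. f2 z a (b + c))) (at z)"
      by (rule has_derivative_transform_within_open[OF C2_withD(2)[OF C z] \<open>open U\<close> z])
         (simp add: linear_add[OF lin1])
    from has_derivative_unique[OF this has_derivative_add[OF C2_withD(2)[OF C z] C2_withD(2)[OF C z]]]
    show "f2 z a (b + c) = f2 z a b + f2 z a c" by meson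
  next
    fix r b
    have "((\<lambda>y. r *\<^sub>R f1 y b) has_derivative (\<lambda>a. f2 z a (r *\<^sub>R b))) (at z)"
      by (rule has_derivative_transform_within_open[OF C2_withD(2)[OF C z] \<open>open U\<close> z])
         (simp add: linear_scale[OF lin1])
    from has_derivative_unique[OF this has_derivative_scaleR_right[OF C2_withD(2)[OF C z]]]
    show "f2 z a (r *\<^sub>R b) = r *\<^sub>R f2 z a b" by meson
  qed
qed

lemma linear_expand:
  fixes f :: "'a::euclidean_space \<Rightarrow> 'b::real_vector"
  assumes "linear f"
  shows "f a = (\<Sum>i\<in>Basis. (a \<bullet> i) *\<^sub>R f i)"
proof -
  have "f a = f (\<Sum>i\<in>Basis. (a \<bullet> i) *\<^sub>R i)" by (simp add: euclidean_representation)
  also have "\<dots> = (\<Sum>i\<in>Basis. (a \<bullet> i) *\<^sub>R f i)"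
    using assms by (simp add: linear_sum linear_scale)
  finally show ?thesis .
qed

lemma bilinear_expand:
  fixes M :: "'a::euclidean_space \<Rightarrow> 'b::euclidean_space \<Rightarrow> real"
  assumes "\<And>b. linear (\<lambda>a. M a b)" "\<And>a. linear (M a)"
  shows "M a b = (\<Sum>i\<in>Basis. \<Sum>j\<in>Basis. (a \<bullet> i) * (b \<bullet> j) * M i j)"
proof -
  have "M a b = (\<Sum>i\<in>Basis. (a \<bullet> i) * M i b)"
    by (rule linear_expand[OF assms(1), unfolded real_scaleR_def])
  also have "\<dots> = (\<Sum>i\<in>Basis. (a \<bullet> i) * (\<Sum>j\<in>Basis. (b \<bullet> j) * M i j))"
    by (intro sum.cong refl arg_cong2[of _ _ _ _ times]
        linear_expand[OF assms(2), unfolded real_scaleR_def])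
  finally show ?thesis by (simp add: sum_distrib_left mult.assoc)
qed

lemma C2_with_continuous:
  assumes C: "C2_with U f f1 f2" and o: "open U" and s: "S \<subseteq> U"
  shows "continuous_on S f"
    and "continuous_on S a \<Longrightarrow> continuous_on S (\<lambda>z. f1 z (a z))"
    and "continuous_on S a \<Longrightarrow> continuous_on S b \<Longrightarrow> continuous_on S (\<lambda>z. f2 z (a z) (b z))"
proof -
  show "continuous_on S f"
    by (meson C C2_withD(1) continuous_at_imp_continuous_on has_derivative_continuous in_mono s)
  have c1: "continuous_on S (\<lambda>z. f1 z b)" for b
    using s by (intro continuous_at_imp_continuous_on ballI has_derivative_continuous[OF C2_withD(2)[OF C]]) auto
  have c2: "continuous_on S (\<lambda>z. f2 z a b)" for a b
    using C s continuous_on_subset unfolding C2_with_def by blast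
  note L = C2_with_linear[OF C o]
  show "continuous_on S (\<lambda>z. f1 z (a z))" if "continuous_on S a"
  proof -
    have "f1 z (a z) = (\<Sum>i\<in>Basis. (a z \<bullet> i) * f1 z i)" if "z \<in> S" for z
      using linear_expand[OF L(1), of z "a z"] that s by auto
    then show ?thesis
      using that by (subst continuous_on_cong[OF refl]) (auto intro!: continuous_intros c1)
  qed
  show "continuous_on S (\<lambda>z. f2 z (a z) (b z))" if "continuous_on S a" "continuous_on S b"
  proof -
    have "f2 z (a z) (b z) = (\<Sum>i\<in>Basis. \<Sum>j\<in>Basis. (a z \<bullet> i) * (b z \<bullet> j) * f2 z i j)" if "z \<in> S" for z
      using bilinear_expand[OF L(2,3), of z "a z" "b z"] that s by auto
    then show ?thesis
      using that by (subst continuous_on_cong[OF refl]) (auto intro!: continuous_intros c2)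
  qed
qed

lemma C2_with_subset: "C2_with T f f1 f2 \<Longrightarrow> S \<subseteq> T \<Longrightarrow> C2_with S f f1 f2"
  unfolding C2_with_def by (meson continuous_on_subset in_mono)

lemma C2_with_bounded_linear: "bounded_linear f \<Longrightarrow> C2_with U f (\<lambda>_. f) (\<lambda>_ _ _. 0)"
  by (auto simp: C2_with_def bounded_linear_imp_has_derivative)

lemma C2_with_const: "C2_with U (\<lambda>_. c) (\<lambda>_ _. 0) (\<lambda>_ _ _. 0)"
  by (auto simp: C2_with_def)

lemma C2_with_add:
  assumes "C2_with U f f1 f2" "C2_with U g g1 g2"
  shows "C2_with U (\<lambda>z. f z + g z) (\<lambda>z a. f1 z a + g1 z a) (\<lambda>z a b. f2 z a b + g2 z a b)"
  using assms by (auto simp: C2_with_def intro!: has_derivative_add continuous_on_add)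

lemma C2_with_diff:
  assumes "C2_with U f f1 f2" "C2_with U g g1 g2"
  shows "C2_with U (\<lambda>z. f z - g z) (\<lambda>z a. f1 z a - g1 z a) (\<lambda>z a b. f2 z a b - g2 z a b)"
  using assms by (auto simp: C2_with_def intro!: has_derivative_diff continuous_on_diff)

lemma C2_with_mult:
  assumes f: "C2_with U f f1 f2" and g: "C2_with U g g1 g2" and o: "open U"
  shows "C2_with U (\<lambda>z. f z * g z) (\<lambda>z a. f z * g1 z a + f1 z a * g z)
    (\<lambda>z a b. f z * g2 z a b + f1 z a * g1 z b + (f1 z b * g1 z a + f2 z a b * g z))"
  unfolding C2_with_def
proof (intro conjI ballI allI)
  fix z b assume z: "z \<in> U"
  note D = C2_withD[OF f z] C2_withD[OF g z]
  show "((\<lambda>z. f z * g z) has_derivative (\<lambda>a. f z * g1 z a + f1 z a * g z)) (at z)"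
    by (rule has_derivative_mult[OF D(1,3)])
  show "((\<lambda>z. f z * g1 z b + f1 z b * g z) has_derivative
     (\<lambda>a. f z * g2 z a b + f1 z a * g1 z b + (f1 z b * g1 z a + f2 z a b * g z))) (at z)"
    by (intro has_derivative_add has_derivative_mult D)
next
  fix a b
  note c = C2_with_continuous[OF f o order_refl] C2_with_continuous[OF g o order_refl]
  show "continuous_on U (\<lambda>z. f z * g2 z a b + f1 z a * g1 z b + (f1 z b * g1 z a + f2 z a b * g z))"
    by (intro continuous_intros c)
qed

text \<open>Hopf's barrier: subtracting 1 makes it vanish where \<open>f\<close> does, and for large
  \<open>k\<close> the rank-one part with \<open>k\<^sup>2\<close> dominates the part with
  \<open>f2\<close>.\<close>

lemma C2_with_exp:
  assumes f: "C2_with U f f1 f2" and o: "open U"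
  shows "C2_with U (\<lambda>z. exp (k * f z) - 1) (\<lambda>z a. k * exp (k * f z) * f1 z a)
    (\<lambda>z a b. exp (k * f z) * (k\<^sup>2 * (f1 z a * f1 z b) + k * f2 z a b))"
  unfolding C2_with_def
proof (intro conjI ballI allI)
  fix z b assume z: "z \<in> U"
  note D = C2_withD[OF f z]
  show "((\<lambda>z. exp (k * f z) - 1) has_derivative (\<lambda>a. k * exp (k * f z) * f1 z a)) (at z)"
    by (auto intro!: derivative_eq_intros D)
  show "((\<lambda>z. k * exp (k * f z) * f1 z b) has_derivative
     (\<lambda>a. exp (k * f z) * (k\<^sup>2 * (f1 z a * f1 z b) + k * f2 z a b))) (at z)"
    by (auto intro!: derivative_eq_intros D simp: algebra_simps power2_eq_square)
next
  fix a b
  note c = C2_with_continuous[OF f o order_refl]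
  show "continuous_on U (\<lambda>z. exp (k * f z) * (k\<^sup>2 * (f1 z a * f1 z b) + k * f2 z a b))"
    by (intro continuous_intros c)
qed

text \<open>The class of test functions for tangency. Those built in the propagation arguments are
  polynomials in the coordinates, so they are defined on the whole space.\<close>

definition C2 :: "('a::euclidean_space \<Rightarrow> real) \<Rightarrow> bool"
  where "C2 f \<longleftrightarrow> (\<exists>f1 f2. C2_with UNIV f f1 f2)"

lemma C2_const: "C2 (\<lambda>_. c)"
  unfolding C2_def using C2_with_const by blast

lemma C2_bounded_linear: "bounded_linear f \<Longrightarrow> C2 f"
  unfolding C2_def using C2_with_bounded_linear by blast

lemma C2_inner: "C2 (\<lambda>z. z \<bullet> i)"
  by (simp add: C2_bounded_linear bounded_linear_inner_left)

lemma C2_add: "C2 f \<Longrightarrow> C2 g \<Longrightarrow> C2 (\<lambda>z. f z + g z)"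
  unfolding C2_def using C2_with_add by blast

lemma C2_diff: "C2 f \<Longrightarrow> C2 g \<Longrightarrow> C2 (\<lambda>z. f z - g z)"
  unfolding C2_def using C2_with_diff by blast

lemma C2_mult: "C2 f \<Longrightarrow> C2 g \<Longrightarrow> C2 (\<lambda>z. f z * g z)"
  unfolding C2_def using C2_with_mult[OF _ _ open_UNIV] by blast

lemma C2_sum: "(\<And>i. i \<in> I \<Longrightarrow> C2 (f i)) \<Longrightarrow> C2 (\<lambda>z. \<Sum>i\<in>I. f i z)"
  by (induction I rule: infinite_finite_induct) (simp_all add: C2_const C2_add)

lemma C2_norm_power2:
  assumes "\<And>i. i \<in> Basis \<Longrightarrow> C2 (\<lambda>z. g z \<bullet> i)"
  shows "C2 (\<lambda>z. (norm (g z))\<^sup>2)"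
proof -
  have "C2 (\<lambda>z. \<Sum>i\<in>Basis. (g z \<bullet> i) * (g z \<bullet> i))"
    by (intro C2_sum C2_mult assms)
  then show ?thesis
    by (subst power2_norm_eq_inner) (subst euclidean_inner, simp)
qed

lemma C2_continuous: "C2 f \<Longrightarrow> continuous_on S f"
  unfolding C2_def using C2_with_continuous(1)[OF _ open_UNIV] by blast

text \<open>On the line through \<open>z\<close> in direction \<open>e\<close>, a negative second
  derivative would make the first derivative negative just to the right of 0, and the mean value
  theorem would give values below \<open>f z\<close>.\<close>

lemma second_derivative_nonneg_at_min:
  assumes C: "C2_with U f f1 f2" and o: "open U" and z: "z \<in> U"
    and min: "\<forall>\<^sub>F y in nhds z. f z \<le> f y"
  shows "f1 z e = 0" "f2 z e e \<ge> 0"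
proof -
  obtain r where r: "r > 0" "ball z r \<subseteq> U" "\<And>y. y \<in> ball z r \<Longrightarrow> f z \<le> f y"
  proof -
    obtain r1 where "r1 > 0" "\<And>y. dist y z < r1 \<Longrightarrow> f z \<le> f y"
      using min unfolding eventually_nhds_metric by auto
    moreover obtain r2 where "r2 > 0" "ball z r2 \<subseteq> U"
      using o z open_contains_ball by blast
    ultimately show thesis
      by (intro that[of "min r1 r2"]) (auto simp: dist_commute)
  qed
  have lin: "linear (f1 z)" by (rule C2_with_linear(1)[OF C o z])
  have z0: "f1 z = (\<lambda>_. 0)"
    by (rule has_derivative_local_min[OF C2_withD(1)[OF C z]])
       (use min in \<open>simp add: eventually_at_filter eventually_mono\<close>)
  then show "f1 z e = 0" by simp
  show "f2 z e e \<ge> 0"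
  proof (rule ccontr)
    assume neg: "\<not> f2 z e e \<ge> 0"
    then have e0: "e \<noteq> 0"
      using linear_0[OF C2_with_linear(3)[OF C o z]] by auto
    define l where "l = (\<lambda>t. z + t *\<^sub>R e)"
    define s where "s = r / norm e"
    have s: "s > 0" using r(1) e0 by (simp add: s_def)
    have lin_ball: "l t \<in> ball z r" if "\<bar>t\<bar> < s" for t
      using that e0 by (simp add: l_def s_def dist_norm field_simps)
    have dl: "(l has_derivative (\<lambda>h. h *\<^sub>R e)) (at t)" for t
      unfolding l_def by (auto intro!: derivative_eq_intros)
    have d1: "((\<lambda>t. f (l t)) has_real_derivative f1 (l t) e) (at t)" if "\<bar>t\<bar> < s" for t
    proof -
      have lU: "l t \<in> U" using lin_ball[OF that] r(2) by auto
      have "((\<lambda>t. f (l t)) has_derivative (\<lambda>h. f1 (l t) (h *\<^sub>R e))) (at t)"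
        by (rule has_derivative_compose[OF dl C2_withD(1)[OF C lU]])
      then show ?thesis
        by (simp add: has_field_derivative_def linear_scale[OF C2_with_linear(1)[OF C o lU]] mult_commute_abs)
    qed
    have "((\<lambda>t. f1 (l t) e) has_derivative (\<lambda>h. f2 z (h *\<^sub>R e) e)) (at 0)"
      using has_derivative_compose[OF dl[of 0], of "\<lambda>y. f1 y e" "\<lambda>a. f2 z a e"] C2_withD(2)[OF C z]
      by (simp add: l_def)
    then have d2: "((\<lambda>t. f1 (l t) e) has_real_derivative f2 z e e) (at 0)"
      by (simp add: has_field_derivative_def linear_scale[OF C2_with_linear(2)[OF C o z]] mult_commute_abs)
    obtain d where d: "d > 0" "\<And>h. 0 < h \<Longrightarrow> h < d \<Longrightarrow> f1 (l h) e < 0"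
      using DERIV_neg_dec_right[OF d2] neg z0 by (auto simp: l_def)
    define t where "t = min s d / 2"
    have t: "0 < t" "t < s" "t < d" using s d(1) by (auto simp: t_def)
    obtain x where x: "0 < x" "x < t" "f (l t) - f (l 0) = (t - 0) * f1 (l x) e"
      using MVT2[of 0 t "\<lambda>t. f (l t)" "\<lambda>t. f1 (l t) e"] d1 t by force
    moreover have "t * f1 (l x) e < 0"
      using d(2)[of x] x t by (simp add: mult_pos_neg)
    ultimately have "f (l t) < f z" by (simp add: l_def)
    then show False using r(3)[OF lin_ball[of t]] t by auto
  qed
qed

subsection \<open>The Hopf barrier argument\<close>

text \<open>The trace of \<open>M\<close> composed with the derivative of \<open>q \<mapsto> q / sqrt (1 + |q|\<^sup>2)\<close>.\<close>

definition mc_form :: "'h::euclidean_space \<Rightarrow> ('h \<Rightarrow> 'h \<Rightarrow> real) \<Rightarrow> real"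
  where "mc_form q M = (\<Sum>b\<in>Basis. M b b) / sqrt (1 + (norm q)\<^sup>2) - M q q / (sqrt (1 + (norm q)\<^sup>2)) ^ 3"

section \<open>Ellipticity of the curvature form\<close>

lemma psd_le_trace:
  fixes M :: "'h::euclidean_space \<Rightarrow> 'h \<Rightarrow> real"
  assumes l: "\<And>b. linear (\<lambda>a. M a b)" and r: "\<And>a. linear (M a)" and psd: "\<And>a. M a a \<ge> 0"
  shows "M q q \<le> (norm q)\<^sup>2 * (\<Sum>b\<in>Basis. M b b)"
proof -
  have nq: "(norm q)\<^sup>2 = (\<Sum>b\<in>Basis. (q \<bullet> b)\<^sup>2)"
    by (metis (no_types, lifting) euclidean_inner power2_eq_square power2_norm_eq_inner sum.cong)
  \<comment> \<open>a Lagrange identity, which avoids both symmetry of \<open>M\<close> and diagonalisation\<close>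
  have "0 \<le> (\<Sum>b\<in>Basis. \<Sum>c\<in>Basis. M ((q \<bullet> b) *\<^sub>R c - (q \<bullet> c) *\<^sub>R b) ((q \<bullet> b) *\<^sub>R c - (q \<bullet> c) *\<^sub>R b))"
    by (intro sum_nonneg psd)
  also have "\<dots> = (\<Sum>b\<in>Basis. \<Sum>c\<in>Basis. (q \<bullet> b)\<^sup>2 * M c c + (q \<bullet> c)\<^sup>2 * M b b
      - ((q \<bullet> b) * (q \<bullet> c) * M b c + (q \<bullet> b) * (q \<bullet> c) * M c b))"
    by (intro sum.cong refl)
       (simp add: linear_diff[OF l] linear_diff[OF r] linear_scale[OF l] linear_scale[OF r]
          algebra_simps power2_eq_square)
  also have "\<dots> = 2 * ((norm q)\<^sup>2 * (\<Sum>b\<in>Basis. M b b)) - 2 * M q q"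
  proof -
    have 1: "(\<Sum>b\<in>Basis. \<Sum>c\<in>Basis. (q \<bullet> b)\<^sup>2 * M c c) = (norm q)\<^sup>2 * (\<Sum>b\<in>Basis. M b b)"
      by (simp add: nq sum_product)
    have 2: "(\<Sum>b\<in>Basis. \<Sum>c\<in>Basis. (q \<bullet> c)\<^sup>2 * M b b) = (norm q)\<^sup>2 * (\<Sum>b\<in>Basis. M b b)"
      by (subst sum.swap) (rule 1)
    have 3: "(\<Sum>b\<in>Basis. \<Sum>c\<in>Basis. (q \<bullet> b) * (q \<bullet> c) * M b c) = M q q"
      by (rule bilinear_expand[OF l r, symmetric])
    have 4: "(\<Sum>b\<in>Basis. \<Sum>c\<in>Basis. (q \<bullet> b) * (q \<bullet> c) * M c b) = M q q"
      by (subst sum.swap) (simp add: mult.commute[of "q \<bullet> _" "q \<bullet> _"] 3)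
    show ?thesis by (simp add: sum.distrib sum_subtractf 1 2 3 4)
  qed
  finally show ?thesis by simp
qed

text \<open>This is ellipticity: the factor \<open>(1 + |q|^2)^(-3/2)\<close> is the eigenvalue of
  the derivative of \<open>q / sqrt (1 + |q|^2)\<close> in the direction of \<open>q\<close>. With
  \<open>s\<close> the square root, the trace over \<open>s\<close> is \<open>s\<^sup>2\<close>
  times the trace over \<open>s ^ 3\<close>, and \<open>psd_le_trace\<close> absorbs
  \<open>M q q\<close>.\<close>

lemma mc_form_lower:
  assumes l: "\<And>b. linear (\<lambda>a. M a b)" and r: "\<And>a. linear (M a)" and psd: "\<And>a. M a a \<ge> 0"
  shows "mc_form q M \<ge> (\<Sum>b\<in>Basis. M b b) / (sqrt (1 + (norm q)\<^sup>2)) ^ 3"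
proof -
  define s where "s = sqrt (1 + (norm q)\<^sup>2)"
  have s: "s > 0" "s\<^sup>2 = 1 + (norm q)\<^sup>2"
    by (simp_all add: s_def add_pos_nonneg)
  have "(\<Sum>b\<in>Basis. M b b) / s = ((\<Sum>b\<in>Basis. M b b) * s\<^sup>2) / s ^ 3"
    using s(1) by (simp add: power2_eq_square power3_eq_cube)
  then have "mc_form q M = ((\<Sum>b\<in>Basis. M b b) * s\<^sup>2 - M q q) / s ^ 3"
    unfolding mc_form_def s_def[symmetric] by (simp add: diff_divide_distrib)
  also have "\<dots> \<ge> (\<Sum>b\<in>Basis. M b b) / s ^ 3"
    using psd_le_trace[OF l r psd, of q] s
    by (intro divide_right_mono) (auto simp: algebra_simps)
  finally show ?thesis by (simp add: s_def)
qed

lemma mc_form_nonneg: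
  assumes "\<And>b. linear (\<lambda>a. M a b)" "\<And>a. linear (M a)" "\<And>a. M a a \<ge> 0"
  shows "mc_form q M \<ge> 0"
  by (rule order_trans[OF _ mc_form_lower[OF assms]]) (auto intro!: divide_nonneg_nonneg sum_nonneg assms)

text \<open>The trace is a sum of squares \<open>l b * l b\<close>, one of which is nonzero. Applied
  to the derivative of \<phi> along the fields, this gives the strictly positive leading term of the
  barrier.\<close>

lemma mc_form_rank_one_pos:
  assumes "linear l" and "l h \<noteq> 0"
  shows "mc_form q (\<lambda>a b. l a * l b) > 0"
proof -
  obtain b where "b \<in> Basis" "l b \<noteq> 0"
    using linear_expand[OF assms(1), of h] assms(2) by (metis (no_types, lifting) scaleR_zero_right sum.neutral)
  then have "(\<Sum>b\<in>Basis. l b * l b) > 0"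
    by (intro sum_pos2[of _ b]) (auto simp: zero_less_mult_iff linorder_neq_iff)
  then have "0 < (\<Sum>b\<in>Basis. l b * l b) / (sqrt (1 + (norm q)\<^sup>2)) ^ 3"
    by (intro divide_pos_pos zero_less_power) (auto simp: add_pos_nonneg)
  also have "\<dots> \<le> mc_form q (\<lambda>a b. l a * l b)"
    by (rule mc_form_lower)
       (auto intro!: linearI simp: linear_add[OF assms(1)] linear_scale[OF assms(1)] algebra_simps)
  finally show ?thesis .
qed

lemma mc_form_add: "mc_form q (\<lambda>h k. M h k + N h k) = mc_form q M + mc_form q N"
  by (simp add: mc_form_def sum.distrib add_divide_distrib)

lemma mc_form_scale: "mc_form q (\<lambda>h k. c * M h k) = c * mc_form q M"
  by (simp add: mc_form_def sum_distrib_left right_diff_distrib)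

lemma mc_form_diff: "mc_form q (\<lambda>h k. M h k - N h k) = mc_form q M - mc_form q N"
  by (simp add: mc_form_def sum_subtractf diff_divide_distrib)

lemma continuous_on_mc_form:
  assumes q: "continuous_on S q"
    and M: "\<And>b. continuous_on S (\<lambda>z. M z b b)" and Mq: "continuous_on S (\<lambda>z. M z (q z) (q z))"
  shows "continuous_on S (\<lambda>z. mc_form (q z) (M z))"
proof -
  have "1 + (norm x)\<^sup>2 \<noteq> 0" for x :: 'b
    by (metis add_pos_nonneg less_numeral_extra(3) zero_le_power2 zero_less_one)
  then show ?thesis
    unfolding mc_form_def by (intro continuous_intros q M Mq) auto
qed

text \<open>Bony's notion: \<open>V\<close> is orthogonal to all smooth outer normals of \<open>F\<close>.\<close>

definition tangent :: "'a::euclidean_space set \<Rightarrow> ('a \<Rightarrow> 'a) \<Rightarrow> bool"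
  where "tangent F V \<longleftrightarrow> (\<forall>y\<in>F. \<forall>\<phi> \<phi>'. C2 \<phi> \<longrightarrow> (\<phi> has_derivative \<phi>') (at y) \<longrightarrow>
    (\<forall>\<^sub>F z in nhds y. z \<in> F \<longrightarrow> \<phi> z \<le> \<phi> y) \<longrightarrow> \<phi>' (V y) = 0)"

lemma tangentD:
  assumes "tangent F V" "y \<in> F" "C2 \<phi>" "(\<phi> has_derivative \<phi>') (at y)"
    "\<forall>\<^sub>F z in nhds y. z \<in> F \<longrightarrow> \<phi> z \<le> \<phi> y"
  shows "\<phi>' (V y) = 0"
  using assms unfolding tangent_def by blast

lemma compact_continuous_bound:
  fixes f :: "'a::topological_space \<Rightarrow> real"
  assumes "compact K" "continuous_on K f"
  obtains C where "C \<ge> 0" "\<And>z. z \<in> K \<Longrightarrow> \<bar>f z\<bar> \<le> C"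
proof -
  have "bounded (f ` K)"
    using compact_continuous_image[OF assms(2,1)] compact_imp_bounded by blast
  then obtain C where "\<And>z. z \<in> K \<Longrightarrow> norm (f z) \<le> C" by (auto simp: bounded_iff)
  then show thesis by (intro that[of "max 0 C"]) (auto simp: max.coboundedI2)
qed

text \<open>Empty \<open>K\<close> is allowed because the slices to which this is applied may be
  empty.\<close>

lemma compact_positive_lower_bound:
  fixes f :: "'a::topological_space \<Rightarrow> real"
  assumes "compact K" "continuous_on K f" "\<And>z. z \<in> K \<Longrightarrow> f z > 0"
  obtains m where "m > 0" "\<And>z. z \<in> K \<Longrightarrow> m \<le> f z"
proof (cases "K = {}")
  case True
  then show thesis using that[of 1] by simp
next
  case False
  then show thesis
    using continuous_attains_inf[OF assms(1) False assms(2)] assms(3) that by metis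
qed

text \<open>Hopf's argument at a touching point where \<psi> has nonzero derivative along a field:
  \<open>w - \<epsilon> * g\<close> has an interior minimum in a small ball, and the second order
  condition there contradicts \<open>ineq\<close>.\<close>

lemma tangent_zero_set:
  fixes X :: "'a::euclidean_space \<Rightarrow> 'h::euclidean_space \<Rightarrow> 'a"
  assumes o: "open U" and w: "C2_with U w w1 w2" and nonneg: "\<And>z. z \<in> U \<Longrightarrow> 0 \<le> w z"
    and X: "\<And>z. linear (X z)" and cX: "\<And>h. continuous_on U (\<lambda>z. X z h)"
    and cq: "continuous_on U q"
    and ineq: "\<And>K. compact K \<Longrightarrow> K \<subseteq> U \<Longrightarrow> \<exists>C. \<forall>z\<in>K.
      mc_form (q z) (\<lambda>h k. w2 z (X z h) (X z k)) \<le> C * (w z + (\<Sum>b\<in>Basis. \<bar>w1 z b\<bar>))"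
  shows "tangent {z \<in> U. w z = 0} (\<lambda>z. X z h)"
  unfolding tangent_def
proof (intro ballI allI impI, rule ccontr)
  fix y \<psi> \<psi>'
  assume y: "y \<in> {z \<in> U. w z = 0}" and "C2 \<psi>" and d\<psi>: "(\<psi> has_derivative \<psi>') (at y)"
    and touch: "\<forall>\<^sub>F z in nhds y. z \<in> {z \<in> U. w z = 0} \<longrightarrow> \<psi> z \<le> \<psi> y"
    and nz: "\<psi>' (X y h) \<noteq> 0"
  \<comment> \<open>The quadratic term makes the contact strict: on the zero set near
    \<open>y\<close>, \<phi> is negative except at \<open>y\<close>. Value 0 and derivative
    \<open>\<psi>'\<close> at \<open>y\<close> are kept.\<close>
  define \<phi> where "\<phi> = (\<lambda>z. \<psi> z - (\<psi> y + (norm (z - y))\<^sup>2))"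
  have "C2 \<phi>"
    unfolding \<phi>_def
    by (intro C2_diff C2_add C2_const C2_norm_power2 \<open>C2 \<psi>\<close>) (simp add: inner_diff_left C2_diff C2_inner C2_const)
  then obtain \<phi>1 \<phi>2 where \<phi>: "C2_with UNIV \<phi> \<phi>1 \<phi>2" unfolding C2_def by blast
  have "((\<lambda>z. (z - y) \<bullet> (z - y)) has_derivative (\<lambda>a. 0)) (at y)"
    by (auto intro!: derivative_eq_intros)
  then have "(\<phi> has_derivative (\<lambda>a. \<psi>' a - (0 + 0))) (at y)"
    unfolding \<phi>_def power2_norm_eq_inner
    by (intro has_derivative_diff d\<psi> has_derivative_add has_derivative_const)
  from has_derivative_unique[OF this C2_withD(1)[OF \<phi>]] have "\<phi>1 y = \<psi>'" by auto
  with nz have nz: "\<phi>1 y (X y h) \<noteq> 0" by simp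
  note lin = C2_with_linear[OF \<phi> open_UNIV UNIV_I]
  note wlin = C2_with_linear[OF w o]
  have comp: "linear (\<lambda>h. f (X z h))" if "linear f" for f :: "'a \<Rightarrow> real" and z
    using linear_compose[OF X[of z] that] by (simp add: o_def)
  \<comment> \<open>\<open>S\<close> and \<open>R\<close> are the coefficients of
    \<open>\<alpha>\<^sup>2\<close> and \<alpha> when \<open>mc_form\<close> is applied to the
    second derivative of the barrier, up to the exponential factor.\<close>
  define S where "S = (\<lambda>z. mc_form (q z) (\<lambda>h k. \<phi>1 z (X z h) * \<phi>1 z (X z k)))"
  define R where "R = (\<lambda>z. mc_form (q z) (\<lambda>h k. \<phi>2 z (X z h) (X z k)))"
  have cXq: "continuous_on U (\<lambda>z. X z (q z))"
    by (subst linear_expand[OF X]) (intro continuous_intros cX cq)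
  note c\<phi> = C2_with_continuous[OF \<phi> open_UNIV subset_UNIV]
  have cS: "continuous_on U S" and cR: "continuous_on U R"
    unfolding S_def R_def by (intro continuous_on_mc_form cq continuous_intros c\<phi> cX cXq)+
  have "S y > 0"
    unfolding S_def by (rule mc_form_rank_one_pos[OF comp[OF lin(1)]]) (rule nz)
  then have "\<forall>\<^sub>F z in nhds y. S z > S y / 2"
    using cS o y by (intro order_tendstoD) (auto simp: continuous_on_eq_continuous_at continuous_at tendsto_nhds_iff)
  with touch have "\<forall>\<^sub>F z in nhds y. S z > S y / 2 \<and> (z \<in> {z \<in> U. w z = 0} \<longrightarrow> \<psi> z \<le> \<psi> y) \<and> z \<in> U"
    using o y by (auto intro!: eventually_conj eventually_nhds_in_open)
  then obtain r0 where r0: "r0 > 0" "\<And>z. dist z y < r0 \<Longrightarrow> S z > S y / 2 \<and> (z \<in> {z \<in> U. w z = 0} \<longrightarrow> \<psi> z \<le> \<psi> y) \<and> z \<in> U"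
    unfolding eventually_nhds_metric by blast
  define r where "r = r0 / 2"
  define K where "K = cball y r"
  have r: "r > 0" using r0 by (simp add: r_def)
  have K: "compact K" "K \<subseteq> U" and Kprop: "\<And>z. z \<in> K \<Longrightarrow> S z > S y / 2 \<and> z \<in> U"
    "\<And>z. z \<in> K \<Longrightarrow> w z = 0 \<Longrightarrow> \<psi> z \<le> \<psi> y"
    using r0 by (auto simp: K_def r_def dist_commute)
  obtain C1 where C1: "C1 \<ge> 0" "\<And>z. z \<in> K \<Longrightarrow> \<bar>R z\<bar> \<le> C1"
    using compact_continuous_bound[OF K(1) continuous_on_subset[OF cR K(2)]] by blast
  obtain B where B: "B \<ge> 0" "\<And>z. z \<in> K \<Longrightarrow> \<bar>\<phi> z\<bar> \<le> B"
    using compact_continuous_bound[OF K(1) c\<phi>(1)] by blast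
  have "continuous_on K (\<lambda>z. \<Sum>b\<in>Basis. \<bar>\<phi>1 z b\<bar>)" by (intro continuous_intros c\<phi>)
  from compact_continuous_bound[OF K(1) this]
  obtain C3 where C3: "C3 \<ge> 0" "\<And>z. z \<in> K \<Longrightarrow> (\<Sum>b\<in>Basis. \<bar>\<phi>1 z b\<bar>) \<le> C3"
    by (metis abs_le_D1)
  obtain C' where C': "\<And>z. z \<in> K \<Longrightarrow> mc_form (q z) (\<lambda>h k. w2 z (X z h) (X z k)) \<le> C' * (w z + (\<Sum>b\<in>Basis. \<bar>w1 z b\<bar>))"
    using ineq[OF K] by blast
  define C where "C = max 0 C'"
  have C: "C \<ge> 0" by (simp add: C_def)
  define c0 where "c0 = S y / 2"
  have c0: "c0 > 0" using \<open>S y > 0\<close> by (simp add: c0_def)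
  \<comment> \<open>This makes \<open>\<alpha> * c0\<close> exceed all constants of the terms linear
    in \<alpha>; the summand 1 also gives \<open>\<alpha> \<ge> 1\<close>, which bounds
    \<open>C\<close> by \<open>\<alpha> * C\<close> at the end.\<close>
  define \<alpha> where "\<alpha> = (C1 + C + C * C3) / c0 + 1"
  have \<alpha>: "\<alpha> \<ge> 1" "\<alpha> * c0 > C1 + C + C * C3"
    using c0 C1(1) C C3(1) by (auto simp: \<alpha>_def field_simps)
  define g where "g = (\<lambda>z. exp (\<alpha> * \<phi> z) - 1)"
  define g1 where "g1 = (\<lambda>z a. \<alpha> * exp (\<alpha> * \<phi> z) * \<phi>1 z a)"
  define g2 where "g2 = (\<lambda>z a b. exp (\<alpha> * \<phi> z) * (\<alpha>\<^sup>2 * (\<phi>1 z a * \<phi>1 z b) + \<alpha> * \<phi>2 z a b))"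
  have g: "C2_with U g g1 g2"
    unfolding g_def g1_def g2_def by (rule C2_with_subset[OF C2_with_exp[OF \<phi> open_UNIV] subset_UNIV])
  \<comment> \<open>On the rest of the sphere \<phi> is negative, so \<open>g < 0 \<le> w\<close>.
    Only on \<open>L\<close> must \<epsilon> be small, and there strict contact forces
    \<open>w > 0\<close>.\<close>
  define L where "L = {z \<in> sphere y r. 0 \<le> \<phi> z}"
  have "closed {z. 0 \<le> \<phi> z}"
    by (intro closed_Collect_le continuous_intros c\<phi>)
  moreover have "L = sphere y r \<inter> {z. 0 \<le> \<phi> z}" by (auto simp: L_def)
  ultimately have cL: "compact L" by (simp add: compact_Int_closed)
  have LK: "L \<subseteq> K" by (auto simp: L_def K_def)
  have "w z > 0" if "z \<in> L" for z
  proof -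
    have zK: "z \<in> K" and ne: "z \<noteq> y" using that LK r by (auto simp: L_def)
    have "\<psi> z > \<psi> y"
    proof -
      have "(norm (z - y))\<^sup>2 > 0" using ne by simp
      moreover have "\<phi> z \<ge> 0" using that by (simp add: L_def)
      ultimately show ?thesis unfolding \<phi>_def by linarith
    qed
    then have "w z \<noteq> 0" using Kprop(2)[OF zK] by linarith
    then show ?thesis using nonneg[of z] Kprop(1)[OF zK] by force
  qed
  moreover have "continuous_on L w"
    by (rule C2_with_continuous(1)[OF w o]) (use LK K in auto)
  ultimately obtain m where m: "m > 0" "\<And>z. z \<in> L \<Longrightarrow> m \<le> w z"
    using compact_positive_lower_bound[OF cL] by blast
  define \<epsilon> where "\<epsilon> = m / (2 * exp (\<alpha> * B))"
  have \<epsilon>: "\<epsilon> > 0" using m(1) by (simp add: \<epsilon>_def)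
  have \<epsilon>g: "\<epsilon> * g z < m" if "z \<in> K" for z
  proof -
    have "exp (\<alpha> * \<phi> z) \<le> exp (\<alpha> * B)"
      using B(2)[OF that] \<alpha>(1) by (simp add: mult_left_mono)
    then have "g z \<le> exp (\<alpha> * B)" unfolding g_def by linarith
    then have "\<epsilon> * g z \<le> \<epsilon> * exp (\<alpha> * B)" using \<epsilon> by (simp add: mult_left_mono)
    also have "\<dots> < m" using m(1) by (simp add: \<epsilon>_def)
    finally show ?thesis .
  qed
  define f where "f = (\<lambda>z. w z - \<epsilon> * g z)"
  have f: "C2_with U f (\<lambda>z a. w1 z a - \<epsilon> * g1 z a) (\<lambda>z a b. w2 z a b - \<epsilon> * g2 z a b)"
    unfolding f_def by (rule C2_with_diff[OF w]) (use C2_with_mult[OF C2_with_const g o, of \<epsilon>] in simp)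
  have "continuous_on K f" by (rule C2_with_continuous(1)[OF f o K(2)])
  moreover have "K \<noteq> {}" using r by (auto simp: K_def)
  ultimately obtain z where z: "z \<in> K" "\<And>x. x \<in> K \<Longrightarrow> f z \<le> f x"
    using continuous_attains_inf[OF K(1)] by blast
  \<comment> \<open>The value 0 at the centre bounds the minimum of \<open>f\<close> from above,
    while \<open>f\<close> is positive on the sphere; so every minimiser is interior, possibly
    \<open>y\<close> itself.\<close>
  have "\<phi> y = 0" by (simp add: \<phi>_def)
  then have "f y = 0" using y by (simp add: f_def g_def)
  then have fz: "f z \<le> 0" using z(2)[of y] r by (simp add: K_def)
  have zU: "z \<in> U" using Kprop z by blast
  have "z \<notin> sphere y r"
  proof
    assume s: "z \<in> sphere y r"
    show False
    proof (cases "0 \<le> \<phi> z")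
      case True
      then have "z \<in> L" using s by (simp add: L_def)
      then show False using m(2)[of z] \<epsilon>g[OF z(1)] fz by (simp add: f_def)
    next
      case False
      then have "g z < 0" using \<alpha>(1) by (simp add: g_def mult_pos_neg)
      then have "\<epsilon> * g z < 0" using \<epsilon> by (simp add: mult_pos_neg)
      then show False using nonneg[OF zU] fz by (simp add: f_def)
    qed
  qed
  then have "z \<in> ball y r" using z(1) by (auto simp: K_def)
  then have "\<forall>\<^sub>F x in nhds z. f z \<le> f x"
    using z(2) by (auto simp: eventually_nhds K_def intro!: exI[of _ "ball y r"])
  note min = second_derivative_nonneg_at_min[OF f o zU this]
  define E where "E = \<epsilon> * exp (\<alpha> * \<phi> z)"
  have E: "E > 0" using \<epsilon> by (simp add: E_def)
  have wz: "w z \<le> E"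
  proof -
    have "w z \<le> \<epsilon> * g z" using fz by (simp add: f_def)
    also have "\<dots> \<le> E" using \<epsilon> by (simp add: g_def E_def algebra_simps)
    finally show ?thesis .
  qed
  have "w1 z b = \<alpha> * E * \<phi>1 z b" for b
    using min(1)[of b] by (simp add: g1_def E_def)
  then have "(\<Sum>b\<in>Basis. \<bar>w1 z b\<bar>) = \<alpha> * E * (\<Sum>b\<in>Basis. \<bar>\<phi>1 z b\<bar>)"
    using E \<alpha>(1) by (simp add: abs_mult sum_distrib_left)
  also have "\<dots> \<le> \<alpha> * E * C3"
    using C3(2)[OF z(1)] E \<alpha>(1) by (intro mult_left_mono) auto
  finally have w1z: "(\<Sum>b\<in>Basis. \<bar>w1 z b\<bar>) \<le> \<alpha> * E * C3" .
  \<comment> \<open>The Hessian of \<open>f\<close> is nonnegative at the minimum. Inserting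
    \<open>ineq\<close> and the bounds on \<open>w z\<close> and its gradient leaves, after division
    by \<open>E\<close>, \<open>\<alpha>\<^sup>2 * c0\<close> against terms at most linear in
    \<alpha>.\<close>
  have "0 \<le> mc_form (q z) (\<lambda>h k. w2 z (X z h) (X z k) - \<epsilon> * g2 z (X z h) (X z k))"
    using C2_with_linear[OF f o zU]
    by (intro mc_form_nonneg comp min(2)) (auto intro: comp)
  also have "\<dots> = mc_form (q z) (\<lambda>h k. w2 z (X z h) (X z k)) - E * (\<alpha>\<^sup>2 * S z + \<alpha> * R z)"
  proof -
    have "\<epsilon> * g2 z (X z h) (X z k) = E * (\<alpha>\<^sup>2 * (\<phi>1 z (X z h) * \<phi>1 z (X z k)) + \<alpha> * \<phi>2 z (X z h) (X z k))" for h k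
      by (simp add: g2_def E_def)
    then show ?thesis
      by (simp only: mc_form_diff mc_form_scale mc_form_add S_def R_def)
  qed
  also have "\<dots> \<le> C * (w z + (\<Sum>b\<in>Basis. \<bar>w1 z b\<bar>)) - E * (\<alpha>\<^sup>2 * S z + \<alpha> * R z)"
  proof -
    have "C' * (w z + (\<Sum>b\<in>Basis. \<bar>w1 z b\<bar>)) \<le> C * (w z + (\<Sum>b\<in>Basis. \<bar>w1 z b\<bar>))"
      by (intro mult_right_mono) (auto simp: C_def intro!: add_nonneg_nonneg sum_nonneg nonneg zU)
    then show ?thesis using C'[OF z(1)] by linarith
  qed
  also have "\<dots> \<le> C * (E + \<alpha> * E * C3) - E * (\<alpha>\<^sup>2 * c0 - \<alpha> * C1)"
  proof -
    have "C * (w z + (\<Sum>b\<in>Basis. \<bar>w1 z b\<bar>)) \<le> C * (E + \<alpha> * E * C3)"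
      using wz w1z C by (intro mult_left_mono add_mono)
    moreover have "\<alpha>\<^sup>2 * c0 - \<alpha> * C1 \<le> \<alpha>\<^sup>2 * S z + \<alpha> * R z"
    proof -
      have "\<alpha>\<^sup>2 * c0 \<le> \<alpha>\<^sup>2 * S z" using Kprop(1)[OF z(1)] by (intro mult_left_mono) (auto simp: c0_def)
      moreover have "\<alpha> * (- C1) \<le> \<alpha> * R z"
        using C1(2)[OF z(1)] \<alpha>(1) by (intro mult_left_mono) auto
      ultimately show ?thesis by simp
    qed
    ultimately show ?thesis using E by (smt (verit) mult_left_mono)
  qed
  also have "\<dots> = - (E * (\<alpha> * (\<alpha> * c0) - \<alpha> * C1 - C - \<alpha> * (C * C3)))"
    by (simp add: algebra_simps power2_eq_square)
  also have "\<dots> < 0"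
  proof -
    have "\<alpha> * (C1 + C + C * C3) < \<alpha> * (\<alpha> * c0)"
      using \<alpha> by (intro mult_strict_left_mono) auto
    moreover have "C \<le> \<alpha> * C" using \<alpha>(1) C by (simp add: mult_le_cancel_right1)
    ultimately have "0 < \<alpha> * (\<alpha> * c0) - \<alpha> * C1 - C - \<alpha> * (C * C3)"
      by (simp add: algebra_simps)
    then show ?thesis using E by simp
  qed
  finally show False by simp
qed

subsection \<open>Propagation along flows and brackets\<close>

text \<open>Since \<omega> kills \<open>e\<close> and \<open>T\<close>, it is constant along the
  field, whose integral curves are thus straight lines. Applying \<omega> to the definition of
  \<open>x\<close> replaces \<open>\<omega> z\<close> by \<open>\<omega> p\<close>; so
  \<open>x = 0\<close> puts \<open>z\<close> on the curve through \<open>p\<close>.\<close>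

lemma flow_decomposition:
  fixes e T p z :: "'a::real_vector" and s :: real
  assumes "linear \<omega>" "\<omega> e = 0" "\<omega> T = (0::real)"
  defines "x \<equiv> z - p - s *\<^sub>R (e + \<omega> z *\<^sub>R T)"
  shows "z = p + s *\<^sub>R (e + \<omega> p *\<^sub>R T) + x + (s * \<omega> x) *\<^sub>R T"
proof -
  have "z = p + s *\<^sub>R (e + \<omega> z *\<^sub>R T) + x" by (simp add: x_def)
  moreover from arg_cong[OF this, of \<omega>] have "\<omega> z = \<omega> p + \<omega> x"
    by (simp add: linear_add[OF assms(1)] linear_scale[OF assms(1)] assms(2,3))
  ultimately show ?thesis by (simp add: algebra_simps)
qed

text \<open>Maximising \<open>\<sigma> - k |\<Xi>|\<^sup>2\<close> on the zero set, with \<open>\<Xi>\<close> constant along the field and zero exactly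
  on the integral curve through \<open>p\<close>, produces a touching point as soon as the curve leaves the set.\<close>

lemma invariant_along_flow_pos:
  fixes V :: "'a::euclidean_space \<Rightarrow> 'a" and e T :: 'a and \<omega> :: "'a \<Rightarrow> real"
  assumes tan: "tangent F (\<lambda>z. e + \<omega> z *\<^sub>R T)"
    and \<omega>: "bounded_linear \<omega>" "\<omega> e = 0" "\<omega> T = 0" and e: "norm e = 1" "e \<bullet> T = 0"
    and F: "closedin (top_of_set U) F" and "p \<in> F" and "\<delta> > 0"
    and tube: "\<And>z. \<bar>(z - p) \<bullet> e\<bar> \<le> s \<Longrightarrow> norm (z - p - ((z - p) \<bullet> e) *\<^sub>R (e + \<omega> z *\<^sub>R T)) \<le> \<delta> \<Longrightarrow> z \<in> U"
    and s: "0 < s"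
  shows "p + s *\<^sub>R (e + \<omega> p *\<^sub>R T) \<in> F"
proof (rule ccontr)
  assume nF: "p + s *\<^sub>R (e + \<omega> p *\<^sub>R T) \<notin> F"
  define \<sigma> where "\<sigma> = (\<lambda>z. (z - p) \<bullet> e)"
  define \<Xi> where "\<Xi> = (\<lambda>z. z - p - \<sigma> z *\<^sub>R (e + \<omega> z *\<^sub>R T))"
  define \<psi> where "\<psi> = (\<lambda>z. (norm (\<Xi> z))\<^sup>2)"
  have lin\<omega>: "linear \<omega>" using \<omega>(1) by (rule bounded_linear.linear)
  have c\<omega>: "continuous_on A \<omega>" for A
    using \<omega>(1) by (simp add: linear_continuous_on)
  have C\<omega>: "C2 \<omega>" by (rule C2_bounded_linear[OF \<omega>(1)])
  have C\<sigma>: "C2 \<sigma>" unfolding \<sigma>_def by (simp add: inner_diff_left C2_diff C2_inner C2_const)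
  have C\<psi>: "C2 \<psi>"
    unfolding \<psi>_def \<Xi>_def
    by (intro C2_norm_power2)
       (auto simp: inner_diff_left inner_add_left intro!: C2_diff C2_add C2_mult C2_inner C2_const C\<sigma> C\<omega>)
  define Z where "Z = {z. \<bar>\<sigma> z\<bar> \<le> s \<and> norm (\<Xi> z) \<le> \<delta>}"
  have c\<Xi>: "continuous_on A \<Xi>" for A
    unfolding \<Xi>_def \<sigma>_def by (intro continuous_intros c\<omega>)
  have c\<sigma>: "continuous_on A \<sigma>" for A unfolding \<sigma>_def by (intro continuous_intros)
  have ZU: "Z \<subseteq> U" using tube by (auto simp: Z_def \<sigma>_def \<Xi>_def)
  have rec: "z = p + \<sigma> z *\<^sub>R (e + \<omega> p *\<^sub>R T) + \<Xi> z + (\<sigma> z * \<omega> (\<Xi> z)) *\<^sub>R T" for z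
    unfolding \<Xi>_def by (rule flow_decomposition[OF lin\<omega> \<omega>(2,3)])
  obtain B where B: "B > 0" "\<And>x. norm (\<omega> x) \<le> norm x * B"
    using bounded_linear.pos_bounded[OF \<omega>(1)] by blast
  have "bounded Z"
  proof -
    have "norm z \<le> norm p + s * norm (e + \<omega> p *\<^sub>R T) + \<delta> + s * (\<delta> * B) * norm T" if "z \<in> Z" for z
    proof -
      have "norm z \<le> norm p + norm (\<sigma> z *\<^sub>R (e + \<omega> p *\<^sub>R T)) + norm (\<Xi> z) + norm ((\<sigma> z * \<omega> (\<Xi> z)) *\<^sub>R T)"
        by (subst rec[of z]) (intro norm_triangle_le add_mono order_refl)
      also have "\<dots> \<le> norm p + s * norm (e + \<omega> p *\<^sub>R T) + \<delta> + s * (\<delta> * B) * norm T"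
      proof -
        have "\<bar>\<omega> (\<Xi> z)\<bar> \<le> \<delta> * B"
          using B(2)[of "\<Xi> z"] B(1) that by (smt (verit) Z_def mem_Collect_eq mult_right_mono real_norm_def)
        then have "\<bar>\<sigma> z * \<omega> (\<Xi> z)\<bar> \<le> s * (\<delta> * B)"
          using that s unfolding abs_mult by (intro mult_mono) (auto simp: Z_def)
        then show ?thesis
          using that by (auto simp: Z_def intro!: add_mono mult_right_mono)
      qed
      finally show ?thesis .
    qed
    then show ?thesis unfolding bounded_iff by blast
  qed
  moreover have "closed Z"
    unfolding Z_def by (intro closed_Collect_conj closed_Collect_le continuous_intros c\<sigma> c\<Xi>)
  ultimately have "compact Z" by (simp add: compact_eq_bounded_closed)
  obtain G where G: "closed G" "F = U \<inter> G" using F by (auto simp: closedin_closed)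
  have FZ: "F \<inter> Z = Z \<inter> G" using ZU G by auto
  have cFZ: "compact (F \<inter> Z)" unfolding FZ by (rule compact_Int_closed[OF \<open>compact Z\<close> G(1)])
  define Q where "Q = F \<inter> Z \<inter> {z. \<sigma> z = s}"
  have "closed {z. \<sigma> z = s}" by (intro closed_Collect_eq continuous_intros c\<sigma>)
  then have cQ: "compact Q" unfolding Q_def by (rule compact_Int_closed[OF cFZ])
  have "\<psi> z > 0" if "z \<in> Q" for z
  proof -
    have "\<Xi> z \<noteq> 0"
    proof
      assume "\<Xi> z = 0"
      then have "z = p + s *\<^sub>R (e + \<omega> p *\<^sub>R T)"
        using rec[of z] that linear_0[OF lin\<omega>] by (simp add: Q_def)
      then show False using nF that by (simp add: Q_def)
    qed
    then show ?thesis by (simp add: \<psi>_def)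
  qed
  then obtain m where m: "m > 0" "\<And>z. z \<in> Q \<Longrightarrow> m \<le> \<psi> z"
    using compact_positive_lower_bound[OF cQ C2_continuous[OF C\<psi>]] by blast
  define \<mu> where "\<mu> = min m (\<delta>\<^sup>2)"
  have \<mu>: "\<mu> > 0" using m(1) \<open>\<delta> > 0\<close> by (simp add: \<mu>_def)
  \<comment> \<open>At a maximiser, \<open>\<phi> \<ge> \<phi> p = 0\<close> gives
    \<open>k * \<psi> y \<le> \<sigma> y \<le> s < k * \<mu>\<close>. Hence
    \<open>\<psi> y < \<mu>\<close>, which excludes both the lateral boundary of \<open>Z\<close>
    and the end slice \<open>\<sigma> = s\<close>.\<close>
  define k where "k = 2 * s / \<mu>"
  have k: "k > 0" "k * \<mu> = 2 * s" using \<mu> s by (auto simp: k_def)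
  define \<phi> where "\<phi> = (\<lambda>z. \<sigma> z - k * \<psi> z)"
  have C\<phi>: "C2 \<phi>" unfolding \<phi>_def by (intro C2_diff C2_mult C2_const C\<sigma> C\<psi>)
  have pZ: "p \<in> F \<inter> Z" using \<open>p \<in> F\<close> \<open>\<delta> > 0\<close> s by (simp add: Z_def \<sigma>_def \<Xi>_def)
  have "\<phi> p = 0" by (simp add: \<phi>_def \<psi>_def \<Xi>_def \<sigma>_def)
  obtain y where y: "y \<in> F \<inter> Z" "\<And>z. z \<in> F \<inter> Z \<Longrightarrow> \<phi> z \<le> \<phi> y"
    using continuous_attains_sup[OF cFZ _ C2_continuous[OF C\<phi>]] pZ by blast
  have \<phi>y: "\<phi> y \<ge> 0" using y(2)[OF pZ] \<open>\<phi> p = 0\<close> by simp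
  have small: "\<psi> y < \<mu>"
  proof (rule ccontr)
    assume "\<not> \<psi> y < \<mu>"
    then have "2 * s \<le> k * \<psi> y" using k by (metis mult_left_mono not_less order_less_imp_le)
    then show False using \<phi>y y(1) s by (auto simp: \<phi>_def Z_def)
  qed
  have "\<sigma> y \<ge> 0"
  proof -
    have "0 \<le> k * \<psi> y" using k(1) by (simp add: \<psi>_def)
    then show ?thesis using \<phi>y by (simp add: \<phi>_def)
  qed
  moreover have "\<sigma> y \<noteq> s" using m(2)[of y] small y(1) by (auto simp: Q_def \<mu>_def)
  ultimately have \<sigma>y: "- s < \<sigma> y" "\<sigma> y < s" using y(1) s by (auto simp: Z_def)
  have \<Xi>y: "norm (\<Xi> y) < \<delta>"
    using small \<open>\<delta> > 0\<close> by (auto simp: \<psi>_def \<mu>_def intro: power2_less_imp_less)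
  have "open {z. - s < \<sigma> z \<and> \<sigma> z < s \<and> norm (\<Xi> z) < \<delta>}"
    by (intro open_Collect_conj open_Collect_less continuous_intros c\<sigma> c\<Xi>)
  then have "\<forall>\<^sub>F z in nhds y. z \<in> {z. - s < \<sigma> z \<and> \<sigma> z < s \<and> norm (\<Xi> z) < \<delta>}"
    using \<sigma>y \<Xi>y by (intro eventually_nhds_in_open) auto
  then have touch: "\<forall>\<^sub>F z in nhds y. z \<in> F \<longrightarrow> \<phi> z \<le> \<phi> y"
    by eventually_elim (auto intro!: y(2) simp: Z_def)
  define v where "v = e + \<omega> y *\<^sub>R T"
  have \<omega>v: "\<omega> v = 0" by (simp add: v_def linear_add[OF lin\<omega>] linear_scale[OF lin\<omega>] \<omega>)
  have ve: "v \<bullet> e = 1" using e by (simp add: v_def inner_add_left inner_commute[of T] dot_square_norm)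
  have d\<Xi>: "(\<Xi> has_derivative (\<lambda>a. a - ((a \<bullet> e) *\<^sub>R v + (\<sigma> y * \<omega> a) *\<^sub>R T))) (at y)"
    unfolding \<Xi>_def \<sigma>_def v_def
    by (auto intro!: derivative_eq_intros bounded_linear_imp_has_derivative[OF \<omega>(1)])
  have d\<phi>: "(\<phi> has_derivative (\<lambda>a. a \<bullet> e - k * (2 * (\<Xi> y \<bullet> (a - ((a \<bullet> e) *\<^sub>R v + (\<sigma> y * \<omega> a) *\<^sub>R T)))))) (at y)"
    unfolding \<phi>_def \<psi>_def power2_norm_eq_inner
    by (auto intro!: derivative_eq_intros d\<Xi> simp: \<sigma>_def inner_commute algebra_simps)
  \<comment> \<open>Along \<open>v\<close> the derivative of \<Xi> vanishes, because
    \<open>v \<bullet> e = 1\<close> and \<open>\<omega> v = 0\<close>. So \<phi> has derivative 1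
    along the field, against tangency.\<close>
  from tangentD[OF tan _ C\<phi> d\<phi> touch] y(1) show False
    by (simp add: v_def[symmetric] \<omega>v ve)
qed

text \<open>Makes the time and the neighbourhood uniform, by keeping all tubes inside one ball, and
  covers negative times by reversing the field.\<close>

lemma invariant_along_flow:
  fixes e T :: "'a::euclidean_space" and \<omega> :: "'a \<Rightarrow> real"
  assumes tan: "tangent F (\<lambda>z. e + \<omega> z *\<^sub>R T)"
    and \<omega>: "bounded_linear \<omega>" "\<omega> e = 0" "\<omega> T = 0" and e: "norm e = 1" "e \<bullet> T = 0"
    and U: "open U" "p0 \<in> U" and F: "closedin (top_of_set U) F"
  shows "\<exists>r>0. \<forall>p\<in>F \<inter> ball p0 r. \<forall>s. \<bar>s\<bar> \<le> r \<longrightarrow> p + s *\<^sub>R (e + \<omega> p *\<^sub>R T) \<in> F"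
proof -
  obtain R where R: "R > 0" "ball p0 R \<subseteq> U"
    using U open_contains_ball by blast
  obtain B where B: "B > 0" "\<And>x. norm (\<omega> x) \<le> norm x * B"
    using bounded_linear.pos_bounded[OF \<omega>(1)] by blast
  \<comment> \<open>\<open>M\<close> bounds the field at points within distance 1 of
    \<open>p0\<close>. With \<open>r\<close> and \<delta> as below, starting offset, motion along
    the curve, and offset from the curve cost at most \<open>R / 4\<close> each.\<close>
  define M where "M = 1 + (norm p0 + 1) * B * norm T"
  have M: "M \<ge> 1" using B(1) by (simp add: M_def)
  define r where "r = min 1 (R / (4 * M))"
  define \<delta> where "\<delta> = R / 4 / (1 + B * norm T)"
  have r: "0 < r" "r \<le> 1" "r * M \<le> R / 4"
    using R(1) M by (auto simp: r_def min_def field_simps)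
  have BT: "1 + B * norm T > 0" using B(1) by (simp add: add_pos_nonneg)
  have "\<delta> * (1 + B * norm T) = R / 4"
    using BT by (metis \<delta>_def less_irrefl nonzero_divide_eq_eq)
  then have \<delta>: "0 < \<delta>" "\<delta> + \<delta> * B * norm T \<le> R / 4"
    using R(1) BT by (simp add: \<delta>_def, simp add: algebra_simps)
  have tube: "z \<in> U"
    if p: "p \<in> ball p0 r" and s: "\<bar>s\<bar> \<le> r" "\<bar>(z - p) \<bullet> e\<bar> \<le> s"
      and x: "norm (z - p - ((z - p) \<bullet> e) *\<^sub>R (e + \<omega> z *\<^sub>R T)) \<le> \<delta>" for p z s
  proof -
    define t where "t = (z - p) \<bullet> e"
    define \<xi> where "\<xi> = z - p - t *\<^sub>R (e + \<omega> z *\<^sub>R T)"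
    have t: "\<bar>t\<bar> \<le> r" using s by (auto simp: t_def)
    have \<xi>: "norm \<xi> \<le> \<delta>" using x by (simp add: \<xi>_def t_def)
    have "z - p0 = (p - p0) + t *\<^sub>R (e + \<omega> p *\<^sub>R T) + \<xi> + (t * \<omega> \<xi>) *\<^sub>R T"
      using flow_decomposition[OF bounded_linear.linear[OF \<omega>(1)] \<omega>(2,3), of z p t]
      by (simp add: \<xi>_def algebra_simps)
    then have "norm (z - p0) \<le> norm (p - p0) + norm (t *\<^sub>R (e + \<omega> p *\<^sub>R T)) + norm \<xi> + norm ((t * \<omega> \<xi>) *\<^sub>R T)"
      by (metis add_mono norm_triangle_ineq norm_triangle_le order_refl)
    also have "\<dots> < R"
    proof -
      have 1: "norm (p - p0) < r" using p by (simp add: dist_norm norm_minus_commute)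
      have "norm p \<le> norm p0 + norm (p - p0)" by (metis add.commute diff_add_cancel norm_triangle_ineq)
      then have "norm p \<le> norm p0 + 1" using 1 r by linarith
      then have "\<bar>\<omega> p\<bar> \<le> (norm p0 + 1) * B"
        using B(2)[of p] B(1) by (smt (verit) mult_right_mono real_norm_def)
      then have "norm (\<omega> p *\<^sub>R T) \<le> (norm p0 + 1) * B * norm T" by (simp add: mult_right_mono)
      then have "norm (e + \<omega> p *\<^sub>R T) \<le> M"
        using norm_triangle_ineq[of e "\<omega> p *\<^sub>R T"] e by (simp add: M_def)
      then have 2: "norm (t *\<^sub>R (e + \<omega> p *\<^sub>R T)) \<le> r * M"
        using t r by (simp add: mult_mono)
      have "\<bar>\<omega> \<xi>\<bar> \<le> \<delta> * B"
        using B(2)[of \<xi>] B(1) \<xi> by (smt (verit) mult_right_mono real_norm_def)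
      then have "\<bar>t\<bar> * \<bar>\<omega> \<xi>\<bar> \<le> 1 * (\<delta> * B)" using t r by (intro mult_mono) auto
      then have 3: "norm ((t * \<omega> \<xi>) *\<^sub>R T) \<le> \<delta> * B * norm T"
        by (simp add: abs_mult mult_right_mono)
      have "r \<le> r * M" using r M by simp
      then show ?thesis using 1 2 3 \<xi> \<delta> r R(1) by linarith
    qed
    finally show "z \<in> U" using R(2) by (auto simp: dist_norm norm_minus_commute)
  qed
  \<comment> \<open>Tangency is an equation, not an inequality, so it passes to the reversed
    field.\<close>
  have tan': "tangent F (\<lambda>z. - e + (- \<omega> z) *\<^sub>R T)"
    unfolding tangent_def
  proof (intro ballI allI impI)
    fix y \<phi> \<phi>'
    assume a: "y \<in> F" "C2 \<phi>" "(\<phi> has_derivative \<phi>') (at y)" "\<forall>\<^sub>F z in nhds y. z \<in> F \<longrightarrow> \<phi> z \<le> \<phi> y"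
    have "\<phi>' (- (e + \<omega> y *\<^sub>R T)) = 0"
      unfolding linear_neg[OF has_derivative_linear[OF a(3)]] using tangentD[OF tan a] by simp
    then show "\<phi>' (- e + - \<omega> y *\<^sub>R T) = 0"
      by (metis minus_add_distrib scaleR_minus_left)
  qed
  have "p + s *\<^sub>R (e + \<omega> p *\<^sub>R T) \<in> F" if p: "p \<in> F \<inter> ball p0 r" and s: "\<bar>s\<bar> \<le> r" for p s
  proof -
    consider "s = 0" | "s > 0" | "- s > 0" by linarith
    then show ?thesis
    proof cases
      case 1
      then show ?thesis using p by simp
    next
      case 2
      show ?thesis
        by (rule invariant_along_flow_pos[OF tan \<omega> e F _ \<delta>(1) _ 2]) (use p s tube in auto)
    next
      case 3
      have "p + (- s) *\<^sub>R (- e + (- \<omega> p) *\<^sub>R T) \<in> F"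
      proof (rule invariant_along_flow_pos[OF tan' bounded_linear_minus[OF \<omega>(1)] _ _ _ _ F _ \<delta>(1) _ 3])
        fix z
        assume z: "\<bar>(z - p) \<bullet> - e\<bar> \<le> - s"
          "norm (z - p - ((z - p) \<bullet> - e) *\<^sub>R (- e + - \<omega> z *\<^sub>R T)) \<le> \<delta>"
        have "((z - p) \<bullet> - e) *\<^sub>R (- e + - \<omega> z *\<^sub>R T) = ((z - p) \<bullet> e) *\<^sub>R (e + \<omega> z *\<^sub>R T)"
          by (simp add: algebra_simps)
        then show "z \<in> U" using z p s by (intro tube[of p "- s" z]) auto
      qed (use p \<omega> e in \<open>auto simp: linear_neg[OF bounded_linear.linear]\<close>)
      moreover have "(- s) *\<^sub>R (- e + (- \<omega> p) *\<^sub>R T) = s *\<^sub>R (e + \<omega> p *\<^sub>R T)"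
        by (simp add: algebra_simps)
      ultimately show ?thesis by (simp only:)
    qed
  qed
  then show ?thesis using r(1) by blast
qed

text \<open>Following the two flows for times \<open>a\<close>, \<open>b\<close>, \<open>-a\<close>,
  \<open>-b\<close> moves \<open>p\<close> by exactly \<open>a * b * \<kappa>\<close> along
  \<open>T\<close>, with no remainder, because each form vanishes on \<open>T\<close> and on its own
  direction.\<close>

lemma invariant_along_bracket:
  fixes e1 e2 T :: "'a::euclidean_space" and \<omega>1 \<omega>2 :: "'a \<Rightarrow> real"
  assumes tan1: "tangent F (\<lambda>z. e1 + \<omega>1 z *\<^sub>R T)" and tan2: "tangent F (\<lambda>z. e2 + \<omega>2 z *\<^sub>R T)"
    and \<omega>1: "bounded_linear \<omega>1" "\<omega>1 e1 = 0" "\<omega>1 T = 0" and e1: "norm e1 = 1" "e1 \<bullet> T = 0"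
    and \<omega>2: "bounded_linear \<omega>2" "\<omega>2 e2 = 0" "\<omega>2 T = 0" and e2: "norm e2 = 1" "e2 \<bullet> T = 0"
    and noncomm: "\<omega>2 e1 \<noteq> \<omega>1 e2"
    and U: "open U" "p0 \<in> U" and F: "closedin (top_of_set U) F"
  shows "\<exists>r>0. \<forall>p\<in>F \<inter> ball p0 r. \<forall>c. \<bar>c\<bar> \<le> r \<longrightarrow> p + c *\<^sub>R T \<in> F"
proof -
  define V1 where "V1 = (\<lambda>z. e1 + \<omega>1 z *\<^sub>R T)"
  define V2 where "V2 = (\<lambda>z. e2 + \<omega>2 z *\<^sub>R T)"
  define \<kappa> where "\<kappa> = \<omega>2 e1 - \<omega>1 e2"
  have \<kappa>: "\<bar>\<kappa>\<bar> > 0" using noncomm by (simp add: \<kappa>_def)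
  obtain r1 where r1: "r1 > 0" "\<And>p s. p \<in> F \<Longrightarrow> p \<in> ball p0 r1 \<Longrightarrow> \<bar>s\<bar> \<le> r1 \<Longrightarrow> p + s *\<^sub>R V1 p \<in> F"
    using invariant_along_flow[OF tan1 \<omega>1 e1 U F] unfolding V1_def by blast
  obtain r2 where r2: "r2 > 0" "\<And>p s. p \<in> F \<Longrightarrow> p \<in> ball p0 r2 \<Longrightarrow> \<bar>s\<bar> \<le> r2 \<Longrightarrow> p + s *\<^sub>R V2 p \<in> F"
    using invariant_along_flow[OF tan2 \<omega>2 e2 U F] unfolding V2_def by blast
  define r where "r = min r1 r2"
  have r: "r > 0" using r1 r2 by (simp add: r_def)
  have "continuous_on (cball p0 r) (\<lambda>z. norm (V1 z) + norm (V2 z))"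
    unfolding V1_def V2_def
    by (intro continuous_intros linear_continuous_on \<omega>1(1) \<omega>2(1))
  from compact_continuous_bound[OF compact_cball this] obtain M0 where
    M0: "M0 \<ge> 0" "\<And>z. z \<in> cball p0 r \<Longrightarrow> \<bar>norm (V1 z) + norm (V2 z)\<bar> \<le> M0" by blast
  \<comment> \<open>Leaves room for three moves, each shorter than \<open>\<rho> * (M0 + 1)\<close>:
    the fourth flow must still start inside \<open>ball p0 r\<close>, where invariance is
    known.\<close>
  define \<rho> where "\<rho> = r / (1 + 3 * (M0 + 1))"
  have "\<rho> * (1 + 3 * (M0 + 1)) = r" using M0(1) by (simp add: \<rho>_def)
  moreover have "\<rho> > 0" using r M0(1) by (simp add: \<rho>_def)
  moreover from this have "\<rho> * (M0 + 1) > 0" using M0(1) by simp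
  ultimately have \<rho>: "\<rho> > 0" "\<rho> \<le> r" "\<rho> + 3 * (\<rho> * (M0 + 1)) = r"
    by (auto simp: algebra_simps)
  have step: "z + a *\<^sub>R V z \<in> ball p0 (t + \<rho> * (M0 + 1))"
    if "z \<in> ball p0 t" "t \<le> r" "\<bar>a\<bar> \<le> \<rho>" "V = V1 \<or> V = V2" for z a t V
  proof -
    have "norm (V z) \<le> norm (V1 z) + norm (V2 z)" using that(4) by auto
    also have "\<dots> \<le> M0" using M0(2)[of z] that by auto
    finally have "norm (V z) \<le> M0 + 1" by simp
    then have "norm (a *\<^sub>R V z) \<le> \<rho> * (M0 + 1)"
      using that(3) \<rho>(1) by (simp add: mult_mono)
    moreover have "norm (z + a *\<^sub>R V z - p0) \<le> norm (z - p0) + norm (a *\<^sub>R V z)"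
      by (metis add_diff_eq diff_add_eq norm_triangle_ineq)
    ultimately show ?thesis using that(1) by (simp add: dist_norm norm_minus_commute)
  qed
  have inF: "z + a *\<^sub>R V z \<in> F"
    if "z \<in> F" "z \<in> ball p0 t" "t \<le> r" "\<bar>a\<bar> \<le> \<rho>" "V = V1 \<or> V = V2" for z a t V
    using that r1(2)[of z a] r2(2)[of z a] \<rho>(2) by (auto simp: r_def)
  define r' where "r' = min \<rho> (\<rho>\<^sup>2 * \<bar>\<kappa>\<bar>)"
  have "p + c *\<^sub>R T \<in> F" if p: "p \<in> F \<inter> ball p0 r'" and c: "\<bar>c\<bar> \<le> r'" for p c
  proof -
    \<comment> \<open>Times of equal size with \<open>a * b * \<kappa> = c\<close>; the sign of
      \<open>b\<close> selects the direction, and the bound on \<open>c\<close> in \<open>r'\<close>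
      keeps both times within \<rho>.\<close>
    define a where "a = sqrt (\<bar>c\<bar> / \<bar>\<kappa>\<bar>)"
    define b where "b = sgn (c * \<kappa>) * a"
    have "a\<^sup>2 = \<bar>c\<bar> / \<bar>\<kappa>\<bar>" by (simp add: a_def)
    also have "\<dots> \<le> \<rho>\<^sup>2" using c \<kappa> by (simp add: r'_def field_simps)
    finally have "a \<le> \<rho>" by (rule power2_le_imp_le) (use \<rho>(1) in simp)
    moreover have "0 \<le> a" by (simp add: a_def)
    ultimately have a: "\<bar>a\<bar> \<le> \<rho>" by simp
    have b: "\<bar>b\<bar> \<le> \<rho>" using a \<rho>(1) by (simp add: b_def abs_mult abs_sgn_eq)
    have ab: "a * b * \<kappa> = c"
    proof -
      have "a * b * \<kappa> = sgn (c * \<kappa>) * a\<^sup>2 * \<kappa>" by (simp add: b_def power2_eq_square)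
      also have "\<dots> = sgn c * \<bar>c\<bar> * (sgn \<kappa> * \<kappa> / \<bar>\<kappa>\<bar>)" by (simp add: a_def sgn_mult)
      also have "\<dots> = c" using \<kappa> by (simp add: sgn_mult_abs) (simp add: sgn_if)
      finally show ?thesis .
    qed
    define p1 where "p1 = p + a *\<^sub>R V1 p"
    define p2 where "p2 = p1 + b *\<^sub>R V2 p1"
    define p3 where "p3 = p2 + (- a) *\<^sub>R V1 p2"
    define p4 where "p4 = p3 + (- b) *\<^sub>R V2 p3"
    define h where "h = \<rho> * (M0 + 1)"
    have h: "h > 0" "\<rho> + 3 * h = r" using \<rho> M0 by (auto simp: h_def)
    have pb: "p \<in> ball p0 \<rho>" using p by (simp add: r'_def)
    have p1b: "p1 \<in> ball p0 (\<rho> + h)"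
      unfolding p1_def h_def by (rule step[OF pb \<rho>(2) a]) simp
    have p2b: "p2 \<in> ball p0 (\<rho> + h + h)"
      unfolding p2_def h_def by (rule step) (use p1b h b in \<open>auto simp: h_def\<close>)
    have p3b: "p3 \<in> ball p0 (\<rho> + h + h + h)"
      unfolding p3_def h_def by (rule step) (use p2b h a in \<open>auto simp: h_def\<close>)
    have "p1 \<in> F" unfolding p1_def by (rule inF[OF _ pb]) (use p a \<rho> in auto)
    then have "p2 \<in> F" unfolding p2_def by (rule inF[OF _ p1b]) (use b h in auto)
    then have "p3 \<in> F" unfolding p3_def by (rule inF[OF _ p2b]) (use a h in auto)
    then have "p4 \<in> F" unfolding p4_def by (rule inF[OF _ p3b]) (use b h in auto)
    moreover have "p4 = p + (a * b * \<kappa>) *\<^sub>R T"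
    proof -
      note l1 = bounded_linear.linear[OF \<omega>1(1)] and l2 = bounded_linear.linear[OF \<omega>2(1)]
      show ?thesis
        unfolding p4_def p3_def p2_def p1_def V1_def V2_def \<kappa>_def
        by (simp add: linear_add[OF l1] linear_scale[OF l1] linear_diff[OF l1] linear_add[OF l2]
            linear_scale[OF l2] linear_diff[OF l2] \<omega>1 \<omega>2 algebra_simps)
    qed
    ultimately show ?thesis by (simp add: ab)
  qed
  moreover have "r' > 0" using \<rho>(1) \<kappa> by (simp add: r'_def)
  ultimately show ?thesis by blast
qed

text \<open>By the invariance, a nearest point to \<open>q\<close> in the slice through \<open>q\<close> orthogonal to \<open>T\<close> is a
  touching point for the distance to the line \<open>q + \<real> T\<close>.\<close>

lemma tangent_fills_neighbourhood:
  fixes T :: "'a::euclidean_space"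
  assumes U: "open U" and F: "closedin (top_of_set U) F" and p0: "p0 \<in> F" and T: "norm T = 1"
    and shift: "\<rho> > 0" "\<And>p c. p \<in> F \<Longrightarrow> p \<in> ball p0 \<rho> \<Longrightarrow> \<bar>c\<bar> \<le> \<rho> \<Longrightarrow> p + c *\<^sub>R T \<in> F"
    and fields: "\<And>e. e \<bullet> T = 0 \<Longrightarrow> \<exists>V. tangent F V \<and> (\<forall>y. \<exists>c. V y = e + c *\<^sub>R T)"
  shows "\<forall>\<^sub>F q in nhds p0. q \<in> F"
proof -
  have TT: "T \<bullet> T = 1" using T by (simp add: dot_square_norm)
  have "p0 \<in> U" using p0 F by (auto simp: closedin_def)
  then obtain R where R: "R > 0" "ball p0 R \<subseteq> U"
    using U open_contains_ball by blast
  define r where "r = min \<rho> R"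
  have r: "r > 0" "r \<le> \<rho>" "ball p0 r \<subseteq> U" using shift R by (auto simp: r_def)
  have innerT: "\<bar>a \<bullet> T\<bar> \<le> norm a" for a
    using Cauchy_Schwarz_ineq2[of a T] T by simp
  have "q \<in> F" if q: "q \<in> ball p0 (r / 4)" for q
  proof -
    obtain G where G: "closed G" "F = U \<inter> G" using F by (auto simp: closedin_closed)
    define S where "S = cball p0 (r / 2) \<inter> {z \<in> G. (z - q) \<bullet> T = 0}"
    have "cball p0 (r / 2) \<subseteq> U" using r by (auto intro!: subsetD[OF r(3)])
    then have S: "S = {z \<in> F. dist p0 z \<le> r / 2 \<and> (z - q) \<bullet> T = 0}"
      using G(2) by (auto simp: S_def)
    have "closed {z. z \<in> G \<and> (z - q) \<bullet> T = 0}"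
      by (intro closed_Collect_conj closed_Collect_eq continuous_intros) (simp add: G(1))
    then have cS: "compact S" unfolding S_def by (intro compact_Int_closed) auto
    \<comment> \<open>The translate of \<open>p0\<close> into the slice through \<open>q\<close>. It
      shows that \<open>S\<close> is nonempty, and its distance to \<open>q\<close> forces the
      nearest point \<open>y\<close> into the interior of the ball of radius
      \<open>r / 2\<close>.\<close>
    define x where "x = p0 + ((q - p0) \<bullet> T) *\<^sub>R T"
    have dq: "norm (q - p0) < r / 4" using q by (simp add: dist_norm norm_minus_commute)
    have cq: "\<bar>(q - p0) \<bullet> T\<bar> < r / 4" using innerT[of "q - p0"] dq by linarith
    have "x \<in> F" unfolding x_def
      using p0 shift(1) cq r by (intro shift(2)) auto
    moreover have "dist p0 x \<le> r / 2" using cq T r(1) by (simp add: x_def dist_norm)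
    moreover have "(x - q) \<bullet> T = 0"
      by (simp add: x_def inner_diff_left inner_add_left TT)
    ultimately have xS: "x \<in> S" by (simp add: S)
    have "continuous_on S (\<lambda>z. norm (z - q))" by (intro continuous_intros)
    then obtain y where y: "y \<in> S" "\<And>z. z \<in> S \<Longrightarrow> norm (y - q) \<le> norm (z - q)"
      using continuous_attains_inf[OF cS] xS by blast
    have "norm (x - q) \<le> norm (q - p0)"
    proof -
      define a where "a = q - p0"
      have "x - q = (a \<bullet> T) *\<^sub>R T - a" by (simp add: x_def a_def)
      then have "(norm (x - q))\<^sup>2 = (norm a)\<^sup>2 - (a \<bullet> T)\<^sup>2"
        unfolding power2_norm_eq_inner
        by (simp add: inner_diff_left inner_diff_right TT inner_commute[of T a] power2_eq_square)
      then have "(norm (x - q))\<^sup>2 \<le> (norm (q - p0))\<^sup>2"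
        using zero_le_power2[of "a \<bullet> T"] unfolding a_def by linarith
      then show ?thesis by (rule power2_le_imp_le) (rule norm_ge_zero)
    qed
    then have "norm (y - q) < r / 4" using y(2)[OF xS] dq by linarith
    moreover have "norm (y - p0) \<le> norm (y - q) + norm (q - p0)"
      by (metis norm_triangle_ineq diff_add_cancel add_diff_eq)
    ultimately have yp: "norm (y - p0) < r / 2" using dq by linarith
    have yF: "y \<in> F" and yT: "(y - q) \<bullet> T = 0" using y(1) by (auto simp: S)
    define g where "g = (\<lambda>z. (z - q) - ((z - q) \<bullet> T) *\<^sub>R T)"
    define \<phi> where "\<phi> = (\<lambda>z. 0 - (norm (g z))\<^sup>2)"
    have C\<phi>: "C2 \<phi>"
      unfolding \<phi>_def g_def
      by (intro C2_diff C2_const C2_norm_power2)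
         (auto simp: inner_diff_left intro!: C2_diff C2_mult C2_inner C2_const)
    have gy: "g y = y - q" by (simp add: g_def yT)
    have dg: "(g has_derivative (\<lambda>a. a - (a \<bullet> T) *\<^sub>R T)) (at y)"
      unfolding g_def by (auto intro!: derivative_eq_intros)
    have d\<phi>: "(\<phi> has_derivative (\<lambda>a. - 2 * ((y - q) \<bullet> (a - (a \<bullet> T) *\<^sub>R T)))) (at y)"
      unfolding \<phi>_def power2_norm_eq_inner
      by (auto intro!: derivative_eq_intros dg simp: gy inner_commute)
    \<comment> \<open>Half of the room left around \<open>y\<close>: a point within \<open>d\<close>
      of \<open>y\<close>, shifted along \<open>T\<close> by less than \<open>d\<close> into the
      slice, remains in the ball defining \<open>S\<close>.\<close>
    define d where "d = (r / 2 - norm (y - p0)) / 2"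
    have d: "d > 0" "d \<le> r / 4" "2 * d + norm (y - p0) = r / 2"
      using yp by (auto simp: d_def field_simps)
    have "\<phi> z \<le> \<phi> y" if z: "dist z y < d" "z \<in> F" for z
    proof -
      define z' where "z' = z + ((q - z) \<bullet> T) *\<^sub>R T"
      have qz: "(q - z) \<bullet> T = (y - z) \<bullet> T"
        using yT by (simp add: inner_diff_left)
      have dz: "norm (z - y) < d" using z by (simp add: dist_norm)
      have cz: "\<bar>(q - z) \<bullet> T\<bar> < d" using innerT[of "y - z"] dz qz by (simp add: norm_minus_commute)
      have zp: "norm (z - p0) < d + norm (y - p0)"
        using dz norm_triangle_ineq[of "z - y" "y - p0"] by simp
      have "z' \<in> F" unfolding z'_def
        using z(2) zp cz d r by (intro shift(2)) (auto simp: dist_norm norm_minus_commute)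
      moreover have "norm (z' - p0) \<le> r / 2"
      proof -
        have "z' - p0 = (z - p0) + ((q - z) \<bullet> T) *\<^sub>R T" by (simp add: z'_def)
        then have "norm (z' - p0) \<le> norm (z - p0) + norm (((q - z) \<bullet> T) *\<^sub>R T)"
          by (metis norm_triangle_ineq)
        then have "norm (z' - p0) \<le> norm (z - p0) + \<bar>(q - z) \<bullet> T\<bar>" by (simp add: T)
        then show ?thesis using zp cz d by linarith
      qed
      moreover have "(z' - q) \<bullet> T = 0"
        by (simp add: z'_def inner_diff_left inner_add_left TT)
      ultimately have "z' \<in> S" by (simp add: S dist_norm norm_minus_commute)
      then have "norm (y - q) \<le> norm (z' - q)" by (rule y(2))
      moreover have "z' - q = g z" by (simp add: z'_def g_def inner_diff_left algebra_simps)
      ultimately show ?thesis by (simp add: \<phi>_def gy power_mono)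
    qed
    then have touch: "\<forall>\<^sub>F z in nhds y. z \<in> F \<longrightarrow> \<phi> z \<le> \<phi> y"
      using d(1) unfolding eventually_nhds_metric by blast
    \<comment> \<open>The field is chosen after \<open>y\<close>, with direction
      \<open>y - q\<close> modulo \<open>T\<close>. The derivative of \<phi> ignores
      \<open>T\<close>, so tangency reads \<open>|y - q|^2 = 0\<close>, that is
      \<open>q = y\<close>.\<close>
    obtain V c where "tangent F V" "V y = (y - q) + c *\<^sub>R T"
      using fields[OF yT] by blast
    from tangentD[OF this(1) yF C\<phi> d\<phi> touch] this(2) have "(y - q) \<bullet> (y - q) = 0"
      using yT by (simp add: inner_add_left inner_add_right TT)
    then show "q \<in> F" using yF by simp
  qed
  then show ?thesis
    using r(1) by (auto simp: eventually_nhds intro!: exI[of _ "ball p0 (r / 4)"])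
qed

subsection \<open>The curvature of intrinsic graphs\<close>

text \<open>\<open>Ck_on\<close> differentiates partials in basis directions only; general
  directions are recovered by linear expansion.\<close>

lemma smooth_on_imp_C2_with:
  fixes u :: "'a::euclidean_space \<Rightarrow> real"
  assumes "smooth_on u U" and o: "open U"
  obtains u1 u2 where "C2_with U u u1 u2"
proof -
  have "Ck_on 2 u U" using assms(1) by (simp add: smooth_on_def)
  then have u: "u differentiable_on U"
    and pu: "\<And>j. j \<in> Basis \<Longrightarrow> partial j u differentiable_on U"
    and ppu: "\<And>i j. i \<in> Basis \<Longrightarrow> j \<in> Basis \<Longrightarrow> continuous_on U (partial i (partial j u))"
    by (auto simp: numeral_2_eq_2)
  define u1 where "u1 = (\<lambda>z. frechet_derivative u (at z))"
  define u2 where "u2 = (\<lambda>z a b. \<Sum>j\<in>Basis. (b \<bullet> j) * partial a (partial j u) z)"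
  have D: "(f has_derivative frechet_derivative f (at z)) (at z)"
    if "f differentiable_on U" "z \<in> U" for f :: "'a \<Rightarrow> real" and z
    using that o by (metis differentiable_on_def at_within_open frechet_derivative_works)
  have D2: "(partial j u has_derivative (\<lambda>a. partial a (partial j u) z)) (at z)"
    if "j \<in> Basis" "z \<in> U" for j z
    using D[OF pu[OF that(1)] that(2)] by (simp add: partial_def)
  have "C2_with U u u1 u2"
    unfolding C2_with_def
  proof (intro conjI ballI allI)
    fix z assume z: "z \<in> U"
    show "(u has_derivative u1 z) (at z)" unfolding u1_def by (rule D[OF u z])
    fix b
    have "((\<lambda>z. \<Sum>j\<in>Basis. (b \<bullet> j) * partial j u z) has_derivative (\<lambda>a. u2 z a b)) (at z)"
      unfolding u2_def by (intro has_derivative_sum has_derivative_mult_right D2 z)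
    then show "((\<lambda>z. u1 z b) has_derivative (\<lambda>a. u2 z a b)) (at z)"
    proof (rule has_derivative_transform_within_open[OF _ o z])
      fix y assume "y \<in> U"
      then show "(\<Sum>j\<in>Basis. (b \<bullet> j) * partial j u y) = u1 y b"
        using linear_expand[OF has_derivative_linear[OF D[OF u]], of y b] by (simp add: u1_def partial_def)
    qed
  next
    fix a b
    have "partial a (partial j u) z = (\<Sum>i\<in>Basis. (a \<bullet> i) * partial i (partial j u) z)"
      if "j \<in> Basis" "z \<in> U" for j z
      using linear_expand[OF has_derivative_linear[OF D2[OF that]], of a] by simp
    then have "u2 z a b = (\<Sum>j\<in>Basis. (b \<bullet> j) * (\<Sum>i\<in>Basis. (a \<bullet> i) * partial i (partial j u) z))"
      if "z \<in> U" for z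
      using that by (simp add: u2_def)
    moreover have "continuous_on U (\<lambda>z. \<Sum>j\<in>Basis. (b \<bullet> j) * (\<Sum>i\<in>Basis. (a \<bullet> i) * partial i (partial j u) z))"
      by (intro continuous_intros ppu)
    ultimately show "continuous_on U (\<lambda>z. u2 z a b)" by (simp cong: continuous_on_cong)
  qed
  then show thesis by (rule that)
qed

section \<open>Coordinate-free form of the operators of \<open>W\<^sup>u\<close>\<close>

definition embed :: "'m::finite horiz \<Rightarrow> 'm param"
  where "embed h = (fst h, fst (snd h), snd (snd h), 0)"

definition e_tau :: "'m::finite param"
  where "e_tau = (0, 0, 0, 1)"

text \<open>The \<tau>-component of the combination of fields with coefficients \<open>h\<close>.
  For fixed \<open>h\<close> it is linear in \<open>p\<close> and \<open>s\<close> jointly, so its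
  derivative along \<open>a\<close> is again a value of \<open>vert\<close>, with \<open>s\<close>
  replaced by the derivative of \<open>u\<close>.\<close>

definition vert :: "'m::finite param \<Rightarrow> real \<Rightarrow> 'm horiz \<Rightarrow> real"
  where "vert p s h = fst h \<bullet> fst (snd (snd p)) - 2 * s * fst (snd h) - snd (snd h) \<bullet> fst p"

text \<open>\<open>hfield p (u p) h\<close> is the tangent vector at \<open>p\<close> of the combination of the fields of \<open>W\<^sup>u\<close> with
  coefficients \<open>h\<close>.\<close>

definition hfield :: "'m::finite param \<Rightarrow> real \<Rightarrow> 'm horiz \<Rightarrow> 'm param"
  where "hfield p s h = embed h + vert p s h *\<^sub>R e_tau"

lemma linear_hfield: "linear (hfield p s)"
  by (rule linearI) (auto simp: hfield_def embed_def e_tau_def vert_def algebra_simps inner_add_left)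

lemma linear_vert: "linear (vert p s)"
  by (rule linearI) (auto simp: vert_def algebra_simps inner_add_left)

lemma bounded_linear_vert: "bounded_linear (\<lambda>p. vert p 0 h)"
  unfolding vert_def
  by (intro linear_conv_bounded_linear[THEN iffD1] linearI) (auto simp: algebra_simps inner_add_right)

lemma has_derivative_vert:
  assumes "(u has_derivative u') (at p)"
  shows "((\<lambda>q. vert q (u q) h) has_derivative (\<lambda>a. vert a (u' a) h)) (at p)"
  unfolding vert_def by (auto intro!: derivative_eq_intros assms simp: algebra_simps)

lemma continuous_on_hfield:
  assumes "continuous_on S s"
  shows "continuous_on S (\<lambda>z. hfield z (s z) h)"
  unfolding hfield_def vert_def by (intro continuous_intros assms)

text \<open>The parameter \<open>s\<close> is arbitrary since the coefficient vector has middle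
  component 0, which removes the term \<open>-2s\<close>.\<close>

lemma e_lo_eq:
  assumes "(f has_derivative f') (at p)"
  shows "e_lo j f p = f' (hfield p s (axis j 1, 0, 0))"
proof -
  obtain x r y t where p: "p = (x, r, y, t)" by (cases p) auto
  have lin: "linear f'" using assms by (rule has_derivative_linear)
  have "hfield p s (axis j 1, 0, 0) = (axis j 1, 0, 0, 0) + (y $ j) *\<^sub>R (0, 0, 0, 1)"
    by (simp add: hfield_def embed_def e_tau_def vert_def p inner_axis' zero_prod_def)
  then have "f' (hfield p s (axis j 1, 0, 0)) = f' (axis j 1, 0, 0, 0) + y $ j * f' (0, 0, 0, 1)"
    by (simp only: linear_add[OF lin] linear_scale[OF lin] real_scaleR_def)
  then show ?thesis
    using assms by (simp add: e_lo_def d_lo_def d_tau_def partial_def p frechet_derivative_at[symmetric])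
qed

lemma e_hi_eq:
  assumes "(f has_derivative f') (at p)"
  shows "e_hi j f p = f' (hfield p s (0, 0, axis j 1))"
proof -
  obtain x r y t where p: "p = (x, r, y, t)" by (cases p) auto
  have lin: "linear f'" using assms by (rule has_derivative_linear)
  have "hfield p s (0, 0, axis j 1) = (0, 0, axis j 1, 0) + (- x $ j) *\<^sub>R (0, 0, 0, 1)"
    by (simp add: hfield_def embed_def e_tau_def vert_def p inner_axis' zero_prod_def)
  then have "f' (hfield p s (0, 0, axis j 1)) = f' (0, 0, axis j 1, 0) + (- x $ j) * f' (0, 0, 0, 1)"
    by (simp only: linear_add[OF lin] linear_scale[OF lin] real_scaleR_def)
  then show ?thesis
    using assms by (simp add: e_hi_def d_hi_def d_tau_def partial_def p frechet_derivative_at[symmetric])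
qed

lemma e_mid_eq:
  assumes "(f has_derivative f') (at p)"
  shows "e_mid u f p = f' (hfield p (u p) (0, 1, 0))"
proof -
  have lin: "linear f'" using assms by (rule has_derivative_linear)
  have "hfield p (u p) (0, 1, 0) = (0, 1, 0, 0) + (- 2 * u p) *\<^sub>R (0, 0, 0, 1)"
    by (simp add: hfield_def embed_def e_tau_def vert_def zero_prod_def)
  then have "f' (hfield p (u p) (0, 1, 0)) = f' (0, 1, 0, 0) + (- 2 * u p) * f' (0, 0, 0, 1)"
    by (simp only: linear_add[OF lin] linear_scale[OF lin] real_scaleR_def)
  then show ?thesis
    using assms by (simp add: e_mid_def d_mid_def d_tau_def partial_def frechet_derivative_at[symmetric])
qed

text \<open>Turns all components of \<open>W\<^sup>u\<close> into one linear expression in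
  \<open>h\<close>, so that later computations need no case split over the three index
  blocks.\<close>

lemma W_grad_inner:
  assumes "(f has_derivative f') (at p)"
  shows "W_grad u f p \<bullet> h = f' (hfield p (u p) h)"
proof -
  have lin: "linear f'" using assms by (rule has_derivative_linear)
  have "W_grad u f p \<bullet> b = f' (hfield p (u p) b)" if "b \<in> Basis" for b
    using that
    by (auto simp: Basis_prod_def Basis_vec_def W_grad_def inner_axis zero_prod_def e_lo_eq[OF assms, of _ "u p"]
        e_hi_eq[OF assms, of _ "u p"] e_mid_eq[OF assms])
  moreover have "f' (hfield p (u p) h) = (\<Sum>b\<in>Basis. (h \<bullet> b) * f' (hfield p (u p) b))"
    using linear_expand[OF linear_compose[OF linear_hfield[of p "u p"] lin], where a = h] by simp
  moreover have "W_grad u f p \<bullet> h = (\<Sum>b\<in>Basis. (W_grad u f p \<bullet> b) * (h \<bullet> b))"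
    by (rule euclidean_inner)
  ultimately show ?thesis by (simp add: mult.commute)
qed

lemma sum_Basis_vec: "(\<Sum>b\<in>(Basis :: (real ^ 'n) set). f b) = (\<Sum>j\<in>(UNIV :: 'n::finite set). f (axis j 1))"
  by (rule sum.reindex_cong[of "\<lambda>j. axis j 1"]) (auto intro!: injI simp: axis_eq_axis Basis_vec_def)

lemma sum_Basis_prod:
  "(\<Sum>b\<in>(Basis :: ('a::euclidean_space \<times> 'b::euclidean_space) set). f b)
    = (\<Sum>b\<in>Basis. f (b, 0)) + (\<Sum>b\<in>Basis. f (0, b))"
proof -
  have "(\<Sum>b\<in>(Basis :: ('a \<times> 'b) set). f b)
      = (\<Sum>b\<in>(\<lambda>u. (u, 0)) ` Basis. f b) + (\<Sum>b\<in>(\<lambda>u. (0, u)) ` Basis. f b)"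
    unfolding Basis_prod_def by (rule sum.union_disjoint) auto
  also have "(\<Sum>b\<in>(\<lambda>u. (u, 0)) ` (Basis :: 'a set). f b) = (\<Sum>b\<in>Basis. f (b, 0))"
    by (subst sum.reindex) (auto intro!: inj_onI)
  also have "(\<Sum>b\<in>(\<lambda>u. (0, u)) ` (Basis :: 'b set). f b) = (\<Sum>b\<in>Basis. f (0, b))"
    by (subst sum.reindex) (auto intro!: inj_onI)
  finally show ?thesis .
qed

lemma W_div_eq:
  assumes "\<And>b. ((\<lambda>q. F q \<bullet> b) has_derivative (\<lambda>a. F' a b)) (at p)"
  shows "W_div u F p = (\<Sum>b\<in>Basis. F' (hfield p (u p) b) b)"
proof -
  have lo: "e_lo j (\<lambda>q. fst (F q) $ j) p = F' (hfield p (u p) (axis j 1, 0, 0)) (axis j 1, 0, 0)" for j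
    by (rule e_lo_eq) (use assms[of "(axis j 1, 0, 0)"] in \<open>simp add: inner_prod_def inner_axis\<close>)
  have hi: "e_hi j (\<lambda>q. snd (snd (F q)) $ j) p = F' (hfield p (u p) (0, 0, axis j 1)) (0, 0, axis j 1)" for j
    by (rule e_hi_eq) (use assms[of "(0, 0, axis j 1)"] in \<open>simp add: inner_prod_def inner_axis\<close>)
  have mid: "e_mid u (\<lambda>q. fst (snd (F q))) p = F' (hfield p (u p) (0, 1, 0)) (0, 1, 0)"
    by (rule e_mid_eq) (use assms[of "(0, 1, 0)"] in \<open>simp add: inner_prod_def\<close>)
  show ?thesis
    unfolding W_div_def lo hi mid
    by (simp add: sum_Basis_prod sum_Basis_vec zero_prod_def)
qed

text \<open>With \<open>s\<close>, \<open>g\<close>, \<open>H\<close> the value and the first two differentials of \<open>u\<close> at \<open>p\<close>, \<open>hhess\<close> is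
  the derivative of \<open>W\<^sup>u(u) \<bullet> k\<close> along \<open>hfield p s h\<close>; its second term comes from differentiating the
  coefficients of the fields, including \<open>-2u\<close>.\<close>

definition hgrad :: "'m::finite param \<Rightarrow> real \<Rightarrow> ('m param \<Rightarrow> real) \<Rightarrow> 'm horiz"
  where "hgrad p s g = (\<Sum>b\<in>Basis. g (hfield p s b) *\<^sub>R b)"

definition hhess :: "'m::finite param \<Rightarrow> real \<Rightarrow> ('m param \<Rightarrow> real) \<Rightarrow> ('m param \<Rightarrow> 'm param \<Rightarrow> real)
    \<Rightarrow> 'm horiz \<Rightarrow> 'm horiz \<Rightarrow> real"
  where "hhess p s g H h k = H (hfield p s h) (hfield p s k) + vert (hfield p s h) (g (hfield p s h)) k * g e_tau"

lemma hgrad_inner: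
  assumes "linear g"
  shows "hgrad p s g \<bullet> h = g (hfield p s h)"
proof -
  have "hgrad p s g \<bullet> h = (\<Sum>b\<in>Basis. (h \<bullet> b) * g (hfield p s b))"
    by (simp add: hgrad_def inner_sum_left inner_commute[of h] mult.commute)
  also have "\<dots> = g (hfield p s h)"
    using linear_expand[OF linear_compose[OF linear_hfield[of p s] assms], where a = h] by simp
  finally show ?thesis .
qed

text \<open>The product rule: differentiating \<open>W\<close> gives the trace term, and
  differentiating the inverse square root gives the term with \<open>M q q\<close>.\<close>

lemma p_mean_curvature_eq:
  fixes u :: "'m::finite param \<Rightarrow> real"
  assumes C: "C2_with U u u1 u2" and o: "open U" and p: "p \<in> U"
  shows "p_mean_curvature u p = mc_form (hgrad p (u p) (u1 p)) (hhess p (u p) (u1 p) (u2 p))"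
proof -
  note lin = C2_with_linear[OF C o]
  define W where "W = W_grad u u"
  have W_inner: "W q \<bullet> h = u1 q (hfield q (u q) h)" if "q \<in> U" for q h
    unfolding W_def by (rule W_grad_inner[OF C2_withD(1)[OF C that]])
  have W_eq: "W q = hgrad q (u q) (u1 q)" if "q \<in> U" for q
    by (rule euclidean_eqI) (simp add: W_inner[OF that] hgrad_inner[OF lin(1)[OF that]])
  \<comment> \<open>The derivative of \<open>W q \<bullet> h\<close> along \<open>a\<close>; at
    \<open>a = hfield p (u p) k\<close> it is \<open>hhess\<close> with arguments \<open>k\<close>
    and \<open>h\<close>. Splitting \<open>hfield\<close> into its constant and \<tau> parts makes
    the dependence on the base point explicit.\<close>
  define D where "D = (\<lambda>a h. u2 p a (hfield p (u p) h) + vert a (u1 p a) h * u1 p e_tau)"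
  have dW: "((\<lambda>q. W q \<bullet> h) has_derivative (\<lambda>a. D a h)) (at p)" for h
  proof -
    have "((\<lambda>q. u1 q (embed h) + vert q (u q) h * u1 q e_tau) has_derivative
        (\<lambda>a. u2 p a (embed h) + (vert p (u p) h * u2 p a e_tau + vert a (u1 p a) h * u1 p e_tau))) (at p)"
      by (intro has_derivative_add has_derivative_mult has_derivative_vert C2_withD[OF C p])
    moreover have "u2 p a (embed h) + (vert p (u p) h * u2 p a e_tau + vert a (u1 p a) h * u1 p e_tau) = D a h" for a
      by (simp add: D_def hfield_def linear_add[OF lin(3)[OF p]] linear_scale[OF lin(3)[OF p]])
    ultimately have "((\<lambda>q. u1 q (embed h) + vert q (u q) h * u1 q e_tau) has_derivative (\<lambda>a. D a h)) (at p)"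
      by simp
    then show ?thesis
    proof (rule has_derivative_transform_within_open[OF _ o p])
      fix q assume "q \<in> U"
      then show "u1 q (embed h) + vert q (u q) h * u1 q e_tau = W q \<bullet> h"
        by (simp add: W_inner hfield_def linear_add[OF lin(1)] linear_scale[OF lin(1)])
    qed
  qed
  define s where "s = sqrt (1 + (norm (W p))\<^sup>2)"
  have s: "s > 0" by (simp add: s_def add_pos_nonneg)
  have dW2: "((\<lambda>q. (norm (W q))\<^sup>2) has_derivative (\<lambda>a. 2 * (\<Sum>b\<in>Basis. (W p \<bullet> b) * D a b))) (at p)"
  proof -
    have "((\<lambda>q. \<Sum>b\<in>Basis. (W q \<bullet> b) * (W q \<bullet> b)) has_derivative
        (\<lambda>a. \<Sum>b\<in>Basis. (W p \<bullet> b) * D a b + D a b * (W p \<bullet> b))) (at p)"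
      by (intro has_derivative_sum has_derivative_mult dW)
    moreover have "(\<Sum>b\<in>Basis. (W p \<bullet> b) * D a b + D a b * (W p \<bullet> b)) = 2 * (\<Sum>b\<in>Basis. (W p \<bullet> b) * D a b)" for a
      by (simp add: sum_distrib_left algebra_simps)
    moreover have "(norm (W q))\<^sup>2 = (\<Sum>b\<in>Basis. (W q \<bullet> b) * (W q \<bullet> b))" for q
      by (simp add: power2_norm_eq_inner euclidean_inner[of "W q" "W q"])
    ultimately show ?thesis by simp
  qed
  have dS: "((\<lambda>q. inverse (sqrt (1 + (norm (W q))\<^sup>2))) has_derivative
      (\<lambda>a. - ((\<Sum>b\<in>Basis. (W p \<bullet> b) * D a b) / s ^ 3))) (at p)"
  proof -
    have "1 + (norm (W p))\<^sup>2 > 0" by (simp add: add_pos_nonneg)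
    then have "((\<lambda>x. inverse (sqrt (1 + x))) has_real_derivative - (1 / (2 * s ^ 3))) (at ((norm (W p))\<^sup>2))"
      using s by (auto intro!: derivative_eq_intros simp: s_def[symmetric] divide_simps power3_eq_cube)
    from DERIV_compose_FDERIV[OF this dW2] show ?thesis by simp
  qed
  have "W_div u (\<lambda>q. W q /\<^sub>R sqrt (1 + (norm (W q))\<^sup>2)) p =
    (\<Sum>h\<in>Basis. inverse s * D (hfield p (u p) h) h
      + (- ((\<Sum>b\<in>Basis. (W p \<bullet> b) * D (hfield p (u p) h) b) / s ^ 3)) * (W p \<bullet> h))"
  proof (rule W_div_eq)
    fix h
    show "((\<lambda>q. (W q /\<^sub>R sqrt (1 + (norm (W q))\<^sup>2)) \<bullet> h) has_derivative
      (\<lambda>a. inverse s * D a h + (- ((\<Sum>b\<in>Basis. (W p \<bullet> b) * D a b) / s ^ 3)) * (W p \<bullet> h))) (at p)"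
      using has_derivative_mult[OF dS dW[of h]] by (simp add: s_def)
  qed
  also have "\<dots> = (\<Sum>h\<in>Basis. D (hfield p (u p) h) h) / s
      - (\<Sum>h\<in>Basis. \<Sum>b\<in>Basis. (W p \<bullet> h) * (W p \<bullet> b) * D (hfield p (u p) h) b) / s ^ 3"
    by (simp add: sum.distrib sum_subtractf sum_negf sum_distrib_left sum_distrib_right sum_divide_distrib
        divide_inverse algebra_simps)
  also have "(\<Sum>h\<in>Basis. \<Sum>b\<in>Basis. (W p \<bullet> h) * (W p \<bullet> b) * D (hfield p (u p) h) b) = D (hfield p (u p) (W p)) (W p)"
  proof (rule bilinear_expand[symmetric, where M = "\<lambda>h k. D (hfield p (u p) h) k"])
    have l: "linear (\<lambda>a. D a k)" for k
      by (rule has_derivative_linear[OF dW])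
    show "linear (\<lambda>h. D (hfield p (u p) h) k)" for k
      using linear_compose[OF linear_hfield l] by (simp add: o_def)
    have "linear (\<lambda>k. u2 p a (hfield p (u p) k))" for a
      using linear_compose[OF linear_hfield lin(3)[OF p]] by (simp add: o_def)
    moreover have "linear (\<lambda>k. vert a r k * c)" for a :: "'m param" and r c
      by (rule linearI) (simp_all add: linear_add[OF linear_vert] linear_scale[OF linear_vert] algebra_simps)
    ultimately show "linear (D (hfield p (u p) h))" for h
      unfolding D_def by (rule linear_compose_add)
  qed
  finally show ?thesis
    unfolding p_mean_curvature_def mc_form_def hhess_def W_eq[OF p, symmetric]
    unfolding W_def[symmetric] s_def[symmetric] by (simp add: D_def)
qed

subsection \<open>The linearised inequality\<close>

text \<open>A pointwise substitute for local Lipschitz continuity in the jet of the graph: \<open>f\<close> and \<open>g\<close> arise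
  from two graphs whose 1-jets are at distance \<open>d\<close>.\<close>

definition lip :: "'a set \<Rightarrow> ('a \<Rightarrow> real) \<Rightarrow> ('a \<Rightarrow> 'b::real_normed_vector) \<Rightarrow> ('a \<Rightarrow> 'b) \<Rightarrow> bool"
  where "lip K d f g \<longleftrightarrow> (\<exists>C\<ge>0. \<forall>z\<in>K. 0 \<le> d z \<and> norm (f z) \<le> C \<and> norm (g z) \<le> C \<and> norm (f z - g z) \<le> C * d z)"

lemma lip_cong: "\<lbrakk>\<And>z. z \<in> K \<Longrightarrow> f z = f' z; \<And>z. z \<in> K \<Longrightarrow> g z = g' z\<rbrakk> \<Longrightarrow> lip K d f g = lip K d f' g'"
  unfolding lip_def by (metis (no_types, lifting))

lemma lipI:
  fixes f g :: "'a::topological_space \<Rightarrow> 'b::real_normed_vector"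
  assumes "compact K" "continuous_on K f" "continuous_on K g"
    and "\<And>z. z \<in> K \<Longrightarrow> norm (f z - g z) \<le> d z"
  shows "lip K d f g"
proof -
  obtain A where A: "A \<ge> 0" "\<And>z. z \<in> K \<Longrightarrow> \<bar>norm (f z)\<bar> \<le> A"
    using compact_continuous_bound[OF assms(1) continuous_on_norm[OF assms(2)]] by blast
  obtain B where B: "B \<ge> 0" "\<And>z. z \<in> K \<Longrightarrow> \<bar>norm (g z)\<bar> \<le> B"
    using compact_continuous_bound[OF assms(1) continuous_on_norm[OF assms(3)]] by blast
  have "norm (f z - g z) \<le> (1 + A + B) * d z" if "z \<in> K" for z
  proof -
    have d: "0 \<le> d z" using assms(4)[OF that] norm_ge_zero order_trans by blast
    then have "1 * d z \<le> (1 + A + B) * d z" using A B by (intro mult_right_mono) auto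
    then show ?thesis using assms(4)[OF that] by simp
  qed
  moreover have "0 \<le> d z" if "z \<in> K" for z
    using assms(4)[OF that] norm_ge_zero order_trans by blast
  ultimately show ?thesis
    unfolding lip_def using A B by (intro exI[of _ "1 + A + B"]) force
qed

lemma lip_refl:
  fixes f :: "'a::topological_space \<Rightarrow> 'b::real_normed_vector"
  assumes "compact K" "\<And>z. z \<in> K \<Longrightarrow> 0 \<le> d z" "continuous_on K f"
  shows "lip K d f f"
  using assms by (intro lipI) auto

lemma lip_add:
  assumes "lip K d f g" "lip K d f' g'"
  shows "lip K d (\<lambda>z. f z + f' z) (\<lambda>z. g z + g' z)"
proof -
  obtain C where C: "C \<ge> 0" "\<And>z. z \<in> K \<Longrightarrow> 0 \<le> d z \<and> norm (f z) \<le> C \<and> norm (g z) \<le> C \<and> norm (f z - g z) \<le> C * d z"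
    using assms(1) unfolding lip_def by blast
  obtain D where D: "D \<ge> 0" "\<And>z. z \<in> K \<Longrightarrow> 0 \<le> d z \<and> norm (f' z) \<le> D \<and> norm (g' z) \<le> D \<and> norm (f' z - g' z) \<le> D * d z"
    using assms(2) unfolding lip_def by blast
  have "norm (f z + f' z - (g z + g' z)) \<le> (C + D) * d z" if "z \<in> K" for z
    using C(2)[OF that] D(2)[OF that] norm_diff_triangle_ineq[of "f z" "f' z" "g z" "g' z"]
    by (simp add: algebra_simps)
  then show ?thesis
    unfolding lip_def using C D by (intro exI[of _ "C + D"]) (auto intro!: norm_triangle_le add_mono)
qed

lemma lip_bounded_linear:
  assumes "bounded_linear L" "lip K d f g"
  shows "lip K d (\<lambda>z. L (f z)) (\<lambda>z. L (g z))"
proof -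
  interpret bounded_linear L by fact
  obtain C where C: "C \<ge> 0" "\<And>z. z \<in> K \<Longrightarrow> 0 \<le> d z \<and> norm (f z) \<le> C \<and> norm (g z) \<le> C \<and> norm (f z - g z) \<le> C * d z"
    using assms(2) unfolding lip_def by blast
  obtain B where B: "B > 0" "\<And>x. norm (L x) \<le> norm x * B"
    using pos_bounded by blast
  have "norm (L x) \<le> c * B" if "norm x \<le> c" for x c
    using B that by (meson less_imp_le mult_right_mono order_trans)
  from this[of _ C] this[of "f _ - g _"] show ?thesis
    unfolding lip_def using B(1) C
    by (intro exI[of _ "C * B"]) (force simp: diff[symmetric] mult.assoc mult.commute[of B])
qed

lemma lip_bounded_bilinear:
  assumes "bounded_bilinear P" "lip K d f g" "lip K d f' g'"
  shows "lip K d (\<lambda>z. P (f z) (f' z)) (\<lambda>z. P (g z) (g' z))"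
proof -
  interpret bounded_bilinear P by fact
  obtain C where C: "C \<ge> 0" "\<And>z. z \<in> K \<Longrightarrow> 0 \<le> d z \<and> norm (f z) \<le> C \<and> norm (g z) \<le> C \<and> norm (f z - g z) \<le> C * d z"
    using assms(2) unfolding lip_def by blast
  obtain D where D: "D \<ge> 0" "\<And>z. z \<in> K \<Longrightarrow> 0 \<le> d z \<and> norm (f' z) \<le> D \<and> norm (g' z) \<le> D \<and> norm (f' z - g' z) \<le> D * d z"
    using assms(3) unfolding lip_def by blast
  obtain B where B: "B > 0" "\<And>x y. norm (P x y) \<le> norm x * norm y * B"
    using pos_bounded by blast
  have P: "norm (P x y) \<le> a * b * B" if "norm x \<le> a" "norm y \<le> b" for x y a b
  proof -
    have "norm x * norm y \<le> a * b"
      using that by (intro mult_mono) (auto intro: order_trans[OF norm_ge_zero])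
    then show ?thesis using B by (meson less_imp_le mult_right_mono order_trans)
  qed
  have "norm (P (f z) (f' z) - P (g z) (g' z)) \<le> 2 * C * D * B * d z" if "z \<in> K" for z
  proof -
    have "P (f z) (f' z) - P (g z) (g' z) = P (f z - g z) (f' z) + P (g z) (f' z - g' z)"
      by (simp add: diff_left diff_right)
    then have "norm (P (f z) (f' z) - P (g z) (g' z)) \<le> norm (P (f z - g z) (f' z)) + norm (P (g z) (f' z - g' z))"
      by (metis norm_triangle_ineq)
    also have "\<dots> \<le> C * d z * D * B + C * (D * d z) * B"
      using C(2)[OF that] D(2)[OF that] by (intro add_mono P) auto
    finally show ?thesis by (simp add: algebra_simps)
  qed
  moreover have "norm (P (f z) (f' z)) \<le> 2 * C * D * B" "norm (P (g z) (g' z)) \<le> 2 * C * D * B" if "z \<in> K" for z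
  proof -
    have "C * D * B \<le> 2 * C * D * B" using B C D by simp
    then show "norm (P (f z) (f' z)) \<le> 2 * C * D * B" "norm (P (g z) (g' z)) \<le> 2 * C * D * B"
      using P[of "f z" C "f' z" D] P[of "g z" C "g' z" D] C(2)[OF that] D(2)[OF that] by linarith+
  qed
  ultimately show ?thesis
    unfolding lip_def using C D B by (intro exI[of _ "2 * C * D * B"]) auto
qed

lemmas lip_mult = lip_bounded_bilinear[OF bounded_bilinear_mult]
  and lip_scaleR = lip_bounded_bilinear[OF bounded_bilinear_scaleR]
  and lip_inner = lip_bounded_bilinear[OF bounded_bilinear_inner]
  and lip_fst = lip_bounded_linear[OF bounded_linear_fst]
  and lip_snd = lip_bounded_linear[OF bounded_linear_snd]

lemma lip_diff:
  assumes "lip K d f g" "lip K d f' g'"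
  shows "lip K d (\<lambda>z. f z - f' z) (\<lambda>z. g z - g' z)"
  using lip_add[OF assms(1) lip_bounded_linear[OF bounded_linear_minus[OF bounded_linear_ident] assms(2)]] by simp

lemma lip_sum:
  assumes "\<And>i. i \<in> I \<Longrightarrow> lip K d (f i) (g i)" "finite I" and d: "\<And>z. z \<in> K \<Longrightarrow> 0 \<le> d z"
  shows "lip K d (\<lambda>z. \<Sum>i\<in>I. f i z) (\<lambda>z. \<Sum>i\<in>I. g i z)"
  using assms(2,1)
proof (induction I)
  case empty
  then show ?case using d by (auto simp: lip_def)
next
  case (insert i I)
  then show ?case by (auto intro!: lip_add)
qed

text \<open>Both roots \<open>x\<close>, \<open>y\<close> are at least 1, so
  \<open>|y - x| / (x * y)\<close> is at most \<open>|y - x| * (y + x)\<close>, the difference of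
  squares.\<close>

lemma inverse_sqrt_diff_le:
  fixes a b :: real
  assumes "a \<ge> 0" "b \<ge> 0"
  shows "\<bar>1 / sqrt (1 + a) - 1 / sqrt (1 + b)\<bar> \<le> \<bar>a - b\<bar>"
proof -
  define x where "x = sqrt (1 + a)"
  define y where "y = sqrt (1 + b)"
  have x: "x \<ge> 1" "x\<^sup>2 = 1 + a" and y: "y \<ge> 1" "y\<^sup>2 = 1 + b"
    using assms by (auto simp: x_def y_def)
  have "\<bar>1 / x - 1 / y\<bar> = \<bar>y - x\<bar> / (x * y)"
    using x y by (simp add: diff_frac_eq abs_mult abs_divide)
  also have "\<dots> \<le> \<bar>y - x\<bar> / 1"
    using x y mult_mono[of 1 x 1 y] by (intro divide_left_mono) auto
  also have "\<dots> \<le> \<bar>y - x\<bar> * (y + x)"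
    using x y mult_left_mono[of 1 "y + x" "\<bar>y - x\<bar>"] by simp
  also have "\<dots> = \<bar>(y - x) * (y + x)\<bar>" using x y by (simp add: abs_mult)
  also have "(y - x) * (y + x) = b - a"
    using x y by (simp add: algebra_simps power2_eq_square)
  finally show ?thesis by (simp add: x_def y_def abs_minus_commute)
qed

lemma lip_inverse_sqrt:
  fixes f g :: "'a \<Rightarrow> real"
  assumes "lip K d f g" "\<And>z. f z \<ge> 0" "\<And>z. g z \<ge> 0"
  shows "lip K d (\<lambda>z. 1 / sqrt (1 + f z)) (\<lambda>z. 1 / sqrt (1 + g z))"
proof -
  obtain C where C: "C \<ge> 0" "\<And>z. z \<in> K \<Longrightarrow> 0 \<le> d z \<and> norm (f z) \<le> C \<and> norm (g z) \<le> C \<and> norm (f z - g z) \<le> C * d z"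
    using assms(1) unfolding lip_def by blast
  have 1: "\<bar>1 / sqrt (1 + x)\<bar> \<le> 1 + C" if "x \<ge> 0" for x
  proof -
    have "1 / sqrt (1 + x) \<le> 1" using that by simp
    moreover have "0 \<le> 1 / sqrt (1 + x)" using that by simp
    ultimately show ?thesis using C(1) by linarith
  qed
  have "\<bar>1 / sqrt (1 + f z) - 1 / sqrt (1 + g z)\<bar> \<le> (1 + C) * d z" if "z \<in> K" for z
    using inverse_sqrt_diff_le[OF assms(2,3), of z z] C(2)[OF that] by (simp add: algebra_simps)
  with 1[OF assms(2)] 1[OF assms(3)] C show ?thesis
    unfolding lip_def by (intro exI[of _ "1 + C"]) auto
qed

text \<open>\<open>mc_form\<close> sees only the entries \<open>M b b\<close> and
  \<open>M q q\<close>, so diagonal control suffices.\<close>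

lemma lip_mc_form:
  assumes q: "lip K d q q'" and M: "\<And>b. lip K d (\<lambda>z. M z b b) (\<lambda>z. M' z b b)"
    and Mq: "lip K d (\<lambda>z. M z (q z) (q z)) (\<lambda>z. M' z (q' z) (q' z))" and d: "\<And>z. z \<in> K \<Longrightarrow> 0 \<le> d z"
  shows "lip K d (\<lambda>z. mc_form (q z) (M z)) (\<lambda>z. mc_form (q' z) (M' z))"
proof -
  have eq: "mc_form x N = (\<Sum>b\<in>Basis. N b b) * (1 / sqrt (1 + x \<bullet> x))
      - N x x * ((1 / sqrt (1 + x \<bullet> x)) * ((1 / sqrt (1 + x \<bullet> x)) * (1 / sqrt (1 + x \<bullet> x))))" for x N
    by (simp add: mc_form_def power2_norm_eq_inner power3_eq_cube)
  show ?thesis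
    unfolding eq by (intro lip_diff lip_mult lip_sum lip_inverse_sqrt lip_inner q M Mq d) auto
qed

section \<open>Dependence of the curvature on the 1-jet\<close>

lemma lip_hfield:
  fixes K :: "'m::finite param set"
  assumes K: "compact K" and d: "\<And>z. z \<in> K \<Longrightarrow> 0 \<le> d z" and s: "lip K d s s'" and h: "lip K d h h'"
  shows "lip K d (\<lambda>z. hfield z (s z) (h z)) (\<lambda>z. hfield z (s' z) (h' z))"
proof -
  have "linear (embed :: 'm horiz \<Rightarrow> 'm param)" by (rule linearI) (auto simp: embed_def)
  then have "bounded_linear (embed :: 'm horiz \<Rightarrow> 'm param)" by (simp add: linear_conv_bounded_linear)
  then show ?thesis
    unfolding hfield_def vert_def
    by (intro lip_add lip_scaleR lip_diff lip_mult lip_inner lip_fst lip_snd s h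
        lip_refl[OF K d] continuous_intros) (auto intro: lip_bounded_linear h)
qed

text \<open>Both sides carry the same second differential \<open>u2\<close>; the change of 1-jet
  acts through \<omega>-free data only: \<open>hgrad\<close>, the fields with their
  \<open>-2u\<close>, and the first order part of \<open>hhess\<close>, all sums and products of
  controlled terms.\<close>

lemma lip_curvature:
  fixes u v :: "'m::finite param \<Rightarrow> real"
  assumes u: "C2_with U u u1 u2" and v: "C2_with U v v1 v2" and o: "open U" and K: "compact K" "K \<subseteq> U"
  defines "d \<equiv> \<lambda>z. \<bar>v z - u z\<bar> + (\<Sum>b\<in>Basis. \<bar>v1 z b - u1 z b\<bar>)"
  shows "lip K d (\<lambda>z. mc_form (hgrad z (u z) (u1 z)) (hhess z (u z) (u1 z) (u2 z)))
    (\<lambda>z. mc_form (hgrad z (v z) (v1 z)) (hhess z (v z) (v1 z) (u2 z)))"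
proof -
  have d: "0 \<le> d z" for z unfolding d_def by (intro add_nonneg_nonneg sum_nonneg) auto
  note cu = C2_with_continuous[OF u o K(2)] and cv = C2_with_continuous[OF v o K(2)]
  have const: "lip K d (\<lambda>_. c) (\<lambda>_. c)" for c :: "'b::real_normed_vector"
    by (rule lip_refl[OF K(1) d]) simp
  have uv: "lip K d u v"
    by (rule lipI[OF K(1) cu(1) cv(1)]) (auto simp: d_def abs_minus_commute intro!: sum_nonneg)
  have basis: "lip K d (\<lambda>z. u1 z i) (\<lambda>z. v1 z i)" if "i \<in> Basis" for i
  proof (rule lipI[OF K(1)])
    fix z
    have "\<bar>v1 z i - u1 z i\<bar> \<le> (\<Sum>b\<in>Basis. \<bar>v1 z b - u1 z b\<bar>)"
      by (rule member_le_sum[OF that]) auto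
    then show "norm (u1 z i - v1 z i) \<le> d z" by (simp add: d_def abs_minus_commute)
  qed (intro cu cv continuous_intros)+
  have D1: "lip K d (\<lambda>z. u1 z (a z)) (\<lambda>z. v1 z (b z))" if "lip K d a b" for a b
  proof -
    have "lip K d (\<lambda>z. \<Sum>i\<in>Basis. (a z \<bullet> i) * u1 z i) (\<lambda>z. \<Sum>i\<in>Basis. (b z \<bullet> i) * v1 z i)"
      by (intro lip_sum lip_mult lip_inner that basis const d) auto
    moreover have "u1 z (a z) = (\<Sum>i\<in>Basis. (a z \<bullet> i) * u1 z i)" "v1 z (b z) = (\<Sum>i\<in>Basis. (b z \<bullet> i) * v1 z i)"
      if "z \<in> K" for z
      using linear_expand[OF C2_with_linear(1)[OF u o], of z "a z"] linear_expand[OF C2_with_linear(1)[OF v o], of z "b z"]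
        that K(2) by auto
    ultimately show ?thesis by (simp cong: lip_cong)
  qed
  have D2: "lip K d (\<lambda>z. u2 z (a z) (a' z)) (\<lambda>z. u2 z (b z) (b' z))" if "lip K d a b" "lip K d a' b'" for a a' b b'
  proof -
    have "lip K d (\<lambda>z. \<Sum>i\<in>Basis. \<Sum>j\<in>Basis. (a z \<bullet> i) * (a' z \<bullet> j) * u2 z i j)
        (\<lambda>z. \<Sum>i\<in>Basis. \<Sum>j\<in>Basis. (b z \<bullet> i) * (b' z \<bullet> j) * u2 z i j)"
      by (intro lip_sum lip_mult lip_inner that const d lip_refl[OF K(1)] cu continuous_intros) auto
    moreover have "u2 z x y = (\<Sum>i\<in>Basis. \<Sum>j\<in>Basis. (x \<bullet> i) * (y \<bullet> j) * u2 z i j)" if "z \<in> K" for z x y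
      by (rule bilinear_expand[OF C2_with_linear(2,3)[OF u o]]) (use that K(2) in auto)
    ultimately show ?thesis by (simp cong: lip_cong)
  qed
  have X: "lip K d (\<lambda>z. hfield z (u z) (a z)) (\<lambda>z. hfield z (v z) (b z))" if "lip K d a b" for a b
    by (rule lip_hfield[OF K(1) d uv that])
  have vert: "lip K d (\<lambda>z. vert (p z) (s z) (h z)) (\<lambda>z. vert (p' z) (s' z) (h' z))"
    if "lip K d p p'" "lip K d s s'" "lip K d h h'" for p p' s s' h h'
    unfolding vert_def by (intro lip_diff lip_mult lip_inner lip_fst lip_snd that const)
  have hh: "lip K d (\<lambda>z. hhess z (u z) (u1 z) (u2 z) (a z) (a z)) (\<lambda>z. hhess z (v z) (v1 z) (u2 z) (b z) (b z))"
    if "lip K d a b" for a b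
    unfolding hhess_def by (intro lip_add lip_mult D2 D1 X vert that const)
  have q: "lip K d (\<lambda>z. hgrad z (u z) (u1 z)) (\<lambda>z. hgrad z (v z) (v1 z))"
    unfolding hgrad_def by (intro lip_sum lip_scaleR D1 X const d) auto
  show ?thesis
    by (intro lip_mc_form q hh const d)
qed

lemma continuous_on_hgrad:
  assumes v: "C2_with U v v1 v2" and o: "open U"
  shows "continuous_on U (\<lambda>z. hgrad z (v z) (v1 z))"
  unfolding hgrad_def
  by (intro continuous_intros C2_with_continuous[OF v o order_refl] continuous_on_hfield)

text \<open>Adding and subtracting the curvature form with the 1-jet of \<open>v\<close> and the
  second differential of \<open>u\<close> splits the comparison into a second order part and the
  error of \<open>lip_curvature\<close>.\<close>

lemma tangent_contact_set:
  fixes u v :: "'m::finite param \<Rightarrow> real"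
  assumes o: "open U" and u: "C2_with U u u1 u2" and v: "C2_with U v v1 v2"
    and le: "\<And>p. p \<in> U \<Longrightarrow> u p \<le> v p"
    and curv: "\<And>p. p \<in> U \<Longrightarrow> p_mean_curvature v p \<le> p_mean_curvature u p"
  shows "tangent {z \<in> U. v z - u z = 0} (\<lambda>z. hfield z (v z) h)"
proof (rule tangent_zero_set[OF o C2_with_diff[OF v u], where q = "\<lambda>z. hgrad z (v z) (v1 z)"])
  show "continuous_on U (\<lambda>z. hgrad z (v z) (v1 z))" by (rule continuous_on_hgrad[OF v o])
  show "continuous_on U (\<lambda>z. hfield z (v z) h)" for h
    by (rule continuous_on_hfield[OF C2_with_continuous(1)[OF v o order_refl]])
  fix K assume K: "compact K" "K \<subseteq> U"
  define d where "d = (\<lambda>z. \<bar>v z - u z\<bar> + (\<Sum>b\<in>Basis. \<bar>v1 z b - u1 z b\<bar>))"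
  obtain C where C: "\<And>z. z \<in> K \<Longrightarrow> norm (mc_form (hgrad z (u z) (u1 z)) (hhess z (u z) (u1 z) (u2 z))
      - mc_form (hgrad z (v z) (v1 z)) (hhess z (v z) (v1 z) (u2 z))) \<le> C * d z"
    using lip_curvature[OF u v o K] unfolding lip_def d_def by blast
  have "mc_form (hgrad z (v z) (v1 z)) (\<lambda>h k. v2 z (hfield z (v z) h) (hfield z (v z) k) - u2 z (hfield z (v z) h) (hfield z (v z) k))
      \<le> C * ((v z - u z) + (\<Sum>b\<in>Basis. \<bar>v1 z b - u1 z b\<bar>))" if z: "z \<in> K" for z
  proof -
    have zU: "z \<in> U" using z K by auto
    \<comment> \<open>The first order parts of the two \<open>hhess\<close> terms coincide, since
      both use the 1-jet of \<open>v\<close>, and cancel in the difference.\<close>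
    have "mc_form (hgrad z (v z) (v1 z)) (\<lambda>h k. v2 z (hfield z (v z) h) (hfield z (v z) k) - u2 z (hfield z (v z) h) (hfield z (v z) k))
      = mc_form (hgrad z (v z) (v1 z)) (\<lambda>h k. hhess z (v z) (v1 z) (v2 z) h k - hhess z (v z) (v1 z) (u2 z) h k)"
      by (simp add: hhess_def)
    also have "\<dots> = p_mean_curvature v z - mc_form (hgrad z (v z) (v1 z)) (hhess z (v z) (v1 z) (u2 z))"
      by (simp add: mc_form_diff p_mean_curvature_eq[OF v o zU])
    also have "\<dots> \<le> p_mean_curvature u z - mc_form (hgrad z (v z) (v1 z)) (hhess z (v z) (v1 z) (u2 z))"
      using curv[OF zU] by simp
    also have "\<dots> \<le> C * d z"
      using C[OF z] by (simp add: p_mean_curvature_eq[OF u o zU])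
    also have "d z = (v z - u z) + (\<Sum>b\<in>Basis. \<bar>v1 z b - u1 z b\<bar>)"
      using le[OF zU] by (simp add: d_def)
    finally show ?thesis .
  qed
  then show "\<exists>C. \<forall>z\<in>K. mc_form (hgrad z (v z) (v1 z)) (\<lambda>h k. v2 z (hfield z (v z) h) (hfield z (v z) k) - u2 z (hfield z (v z) h) (hfield z (v z) k))
      \<le> C * (v z - u z + (\<Sum>b\<in>Basis. \<bar>v1 z b - u1 z b\<bar>))"
    by blast
qed (use le linear_hfield in auto)

theorem theoremE:
  fixes u v :: "'m::finite param \<Rightarrow> real"
    and U :: "'m param set" and p0 :: "'m param"
  assumes "open U" and "p0 \<in> U"
    and "smooth_on v U" and "smooth_on u U"
    and "v p0 = u p0"
    and "d_mid v p0 \<noteq> 0" and "d_mid u p0 \<noteq> 0"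
    and "\<And>p. p \<in> U \<Longrightarrow> u p \<le> v p"
    and "\<And>p. p \<in> U \<Longrightarrow> p_mean_curvature v p \<le> p_mean_curvature u p"
    and "p_mean_curvature v constant_on U \<or> p_mean_curvature u constant_on U"
  shows "\<forall>\<^sub>F p in nhds p0. v p = u p"
proof -
  obtain u1 u2 where u: "C2_with U u u1 u2" using smooth_on_imp_C2_with assms by blast
  obtain v1 v2 where v: "C2_with U v v1 v2" using smooth_on_imp_C2_with assms by blast
  define F where "F = {z \<in> U. v z - u z = 0}"
  have tan: "tangent F (\<lambda>z. hfield z (v z) h)" for h
    unfolding F_def by (rule tangent_contact_set[OF \<open>open U\<close> u v assms(8,9)])
  have "continuous_on U (\<lambda>z. v z - u z)"
    by (intro continuous_intros C2_with_continuous(1)[OF u \<open>open U\<close>] C2_with_continuous(1)[OF v \<open>open U\<close>] order_refl)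
  from continuous_closedin_preimage[OF this closed_singleton[of 0]]
  have F: "closedin (top_of_set U) F"
    by (simp add: F_def vimage_def Int_def)
  have p0: "p0 \<in> F" using assms by (simp add: F_def)
  \<comment> \<open>This is where \<open>n \<ge> 2\<close> enters: types are nonempty, so a
    conjugate pair of fields \<open>j\<close>, \<open>n+j\<close> exists.\<close>
  obtain j :: 'm where True by blast
  define h1 :: "'m horiz" where "h1 = (axis j 1, 0, 0)"
  define h2 :: "'m horiz" where "h2 = (0, 0, axis j 1)"
  \<comment> \<open>Neither field involves the graph function, so both have the affine form required
    by the flow argument.\<close>
  have hf: "hfield z s h1 = embed h1 + vert z 0 h1 *\<^sub>R e_tau" "hfield z s h2 = embed h2 + vert z 0 h2 *\<^sub>R e_tau" for z s
    by (simp_all add: hfield_def vert_def h1_def h2_def)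
  have 1: "tangent F (\<lambda>z. embed h1 + vert z 0 h1 *\<^sub>R e_tau)"
    using tan[of h1] by (simp add: hf)
  have 2: "tangent F (\<lambda>z. embed h2 + vert z 0 h2 *\<^sub>R e_tau)"
    using tan[of h2] by (simp add: hf)
  have "\<exists>r>0. \<forall>p\<in>F \<inter> ball p0 r. \<forall>c. \<bar>c\<bar> \<le> r \<longrightarrow> p + c *\<^sub>R e_tau \<in> F"
    \<comment> \<open>The commutator constant is -2: the \<tau>-coefficients are the coordinates
      \<open>\<eta>^(n+j)\<close> and \<open>-\<eta>^j\<close>, each of which varies along the other
      field.\<close>
    by (rule invariant_along_bracket[OF 1 2 bounded_linear_vert _ _ _ _ bounded_linear_vert _ _ _ _ _ \<open>open U\<close> \<open>p0 \<in> U\<close> F])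
       (simp_all add: vert_def embed_def h1_def h2_def e_tau_def norm_Pair norm_axis_1 inner_axis_axis)
  then obtain r where r: "r > 0" "\<And>p c. p \<in> F \<Longrightarrow> p \<in> ball p0 r \<Longrightarrow> \<bar>c\<bar> \<le> r \<Longrightarrow> p + c *\<^sub>R e_tau \<in> F"
    by blast
  have "\<forall>\<^sub>F q in nhds p0. q \<in> F"
  proof (rule tangent_fills_neighbourhood[OF \<open>open U\<close> F p0 _ r])
    show "norm (e_tau :: 'm param) = 1" by (simp add: e_tau_def norm_Pair)
    \<comment> \<open>A vector orthogonal to the \<tau>-axis is \<open>embed\<close> of its first
      three components, so it is matched, modulo \<tau>, by a combination of the fields of
      \<open>W\<^sup>v\<close>, the middle one included.\<close>
    fix e :: "'m param" assume "e \<bullet> e_tau = 0"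
    then have "embed (fst e, fst (snd e), fst (snd (snd e))) = e"
      by (cases e) (simp add: embed_def e_tau_def)
    then have "hfield y (v y) (fst e, fst (snd e), fst (snd (snd e))) = e + vert y (v y) (fst e, fst (snd e), fst (snd (snd e))) *\<^sub>R e_tau" for y
      by (simp add: hfield_def)
    then show "\<exists>V. tangent F V \<and> (\<forall>y. \<exists>c. V y = e + c *\<^sub>R e_tau)"
      using tan by blast
  qed
  then show ?thesis by (rule eventually_mono) (simp add: F_def)
qed

end
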